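(* Fix $\beta\ge1$. Let $\{X_i\}_{i\ge1}$ be a sequence of independent random variables in a sub-linear expectation space $(\Omega,\mathscr H,\mathbb E)$ with $\mathbb E[X_i]=\mathbb E[-X_i]=0$, $\overline\sigma_i:=\sqrt{\mathbb E[X_i^2]}$, $\underline\sigma_i:=\sqrt{-\mathbb E[-X_i^2]}$, $\overline\sigma_i/\underline\sigma_i=\beta$ for all $i$, and $0<\inf_i\underline\sigma_i^2\le\sup_i\overline\sigma_i^2<\infty$. Put $S_n=\sum_{i=1}^nX_i$, $\sigma_i=(\underline\sigma_i+\overline\sigma_i)/2$, $B_n=\sqrt{\sum_{i=1}^n\sigma_i^2}$, $W_n=S_n/B_n$. Assume the continuity condition (A) below holds for $(\Omega,\mathscr H,\mathbb E)$ and $(\widetilde\Omega,\widetilde{\mathscr H},\widetilde{\mathbb E})$. Let $\alpha\in(0,1)$ be the constant (depending on $\beta$) from Song's convergence-rate theorem described in the context. If $\sup_{i\ge1}\mathbb E[|X_i|^{2+\alpha}]<\infty$, then for every $f\in\mathcal H$, $$\nu\Big(\lim_{n\to\infty}\frac{1}{\log n}\sum_{k\le n}\frac1k f(W_k)=\widetilde{\mathbb E}[f(\xi)]\Big)=1,$$ where $\xi$ is $G$-normally distributed under $\widetilde{\mathbb E}$ with $\sqrt{\widetilde{\mathbb E}[\xi^2]}=\frac{2\beta}{1+\beta}$ and $\sqrt{-\widetilde{\mathbb E}[-\xi^2]}=\frac{2}{1+\beta}$.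
   Context: Sub-linear expectation space $(\Omega,\mathscr H,\mathbb E)$: $(\Omega,\mathcal F)$ a measurable space, $\mathscr H$ a linear space of real measurable functions closed under $(X_1,\dots,X_n)\mapsto\varphi(X_1,\dots,X_n)$ for $\varphi\in C_{b,Lip}(\mathbb R^n)$ (bounded Lipschitz functions), and $\mathbb E:\mathscr H\to\mathbb R$ monotone, constant preserving, sub-additive and positively homogeneous; it is assumed $\mathbb E[X]=\sup_{P\in\mathcal P}E_P[X]$ for a family $\mathcal P$ of $\sigma$-additive probability measures, and $\nu(A)=\inf_{P\in\mathcal P}P(A)$. $(\widetilde\Omega,\widetilde{\mathscr H},\widetilde{\mathbb E})$ is another sub-linear expectation space. Independence: $Y\in\mathscr H^n$ is independent of $X\in\mathscr H^m$ if $\mathbb E[\varphi(X,Y)]=\mathbb E\big[\mathbb E[\varphi(x,Y)]|_{x=X}\big]$ for all $\varphi\in C_{b,Lip}(\mathbb R^{m+n})$ (whenever the relevant quantities are finite); $\{X_n\}$ is independent if $X_{n+1}$ is independent of $(X_1,\dots,X_n)$ for every $n$. Condition (A): for every $X\in\mathscr H$ (resp. $\widetilde{\mathscr H}$) and every sequence $f_n\in C_{b,Lip}(\mathbb R)$ with $f_n\downarrow0$, $\mathbb E[f_n(X)]\downarrow0$ (resp. $\widetilde{\mathbb E}[f_n(X)]\downarrow0$). $G$-normal distribution: $\xi$ is $G$-normal under $\widetilde{\mathbb E}$ if for each $f\in C_{b,Lip}(\mathbb R)$, $u(t,x)=\widetilde{\mathbb E}[f(x+\sqrt t\,\xi)]$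 is the unique viscosity solution of $\partial_tu-G(\partial_{xx}u)=0$ on $(0,\infty)\times\mathbb R$, $u(0,x)=f(x)$, where $G(a)=\frac12\widetilde{\mathbb E}[a\xi^2]$. $\mathcal H:=\{f\in C_{b,Lip}(\mathbb R):\widetilde{\mathbb E}[f(\xi)]=-\widetilde{\mathbb E}[-f(\xi)]\}$. Song's theorem (cited, Theorem 5.1 of Song): there exist $\alpha\in(0,1)$ depending on $\beta$ and $C_{\alpha,\beta}>0$ such that for every sequence as in the claim and every $n\ge1$, $\sup_{|f|_{Lip}\le1}\big|\mathbb E[f(W_n)]-\widetilde{\mathbb E}[f(\xi)]\big|\le C_{\alpha,\beta}\sup_{1\le i\le n}\Big\{\frac{\mathbb E[|X_i|^{2+\alpha}]}{\sigma_i^{2+\alpha}}\big(\frac{\sigma_i}{B_n}\big)^{\alpha}\Big\}$, with $\xi$ as in the claim. The $\alpha$ in the claim is this constant. *)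

theory Defs
  imports "HOL-Probability.Probability"
begin

text \<open>Bounded Lipschitz functions on R^n.  A point of R^n is represented by
  a function x :: nat \<Rightarrow> real of which only the coordinates x 0, ..., x (n-1)
  matter; phi is required not to depend on the other coordinates.\<close>
definition bLip :: "nat \<Rightarrow> ((nat \<Rightarrow> real) \<Rightarrow> real) \<Rightarrow> bool" where
  "bLip n \<phi> \<longleftrightarrow>
     (\<forall>x x'. (\<forall>i<n. x i = x' i) \<longrightarrow> \<phi> x = \<phi> x') \<and>
     (\<exists>B. \<forall>x. \<bar>\<phi> x\<bar> \<le> B) \<and>
     (\<exists>L. \<forall>x x'. \<bar>\<phi> x - \<phi> x'\<bar> \<le> L * (\<Sum>i<n. \<bar>x i - x' i\<bar>))"

definition bLip1 :: "(real \<Rightarrow> real) \<Rightarrow> bool" where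
  "bLip1 f \<longleftrightarrow> (\<exists>B. \<forall>x. \<bar>f x\<bar> \<le> B) \<and> (\<exists>L. \<forall>x y. \<bar>f x - f y\<bar> \<le> L * \<bar>x - y\<bar>)"

definition sublinear_expectation ::
  "'a measure \<Rightarrow> ('a \<Rightarrow> real) set \<Rightarrow> (('a \<Rightarrow> real) \<Rightarrow> real) \<Rightarrow> bool" where
  "sublinear_expectation M H E \<longleftrightarrow>
     (\<forall>X\<in>H. X \<in> borel_measurable M) \<and>
     (\<forall>X\<in>H. \<forall>Y\<in>H. (\<lambda>\<omega>. X \<omega> + Y \<omega>) \<in> H) \<and>
     (\<forall>c. \<forall>X\<in>H. (\<lambda>\<omega>. c * X \<omega>) \<in> H) \<and>
     (\<forall>n X \<phi>. (\<forall>i<n. X i \<in> H) \<longrightarrow> bLip n \<phi> \<longrightarrow> (\<lambda>\<omega>. \<phi> (\<lambda>i. X i \<omega>)) \<in> H) \<and>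
     (\<forall>X\<in>H. \<forall>Y\<in>H. (\<forall>\<omega>\<in>space M. X \<omega> \<le> Y \<omega>) \<longrightarrow> E X \<le> E Y) \<and>
     (\<forall>c. E (\<lambda>\<omega>. c) = c) \<and>
     (\<forall>X\<in>H. \<forall>Y\<in>H. E (\<lambda>\<omega>. X \<omega> + Y \<omega>) \<le> E X + E Y) \<and>
     (\<forall>c\<ge>0. \<forall>X\<in>H. E (\<lambda>\<omega>. c * X \<omega>) = c * E X)"

definition sublinear_space_rep ::
  "'a measure \<Rightarrow> 'a measure set \<Rightarrow> ('a \<Rightarrow> real) set \<Rightarrow> (('a \<Rightarrow> real) \<Rightarrow> real) \<Rightarrow> bool" where
  "sublinear_space_rep M \<P> H E \<longleftrightarrow>
     sublinear_expectation M H E \<and> \<P> \<noteq> {} \<and>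
     (\<forall>P\<in>\<P>. prob_space P \<and> sets P = sets M) \<and>
     (\<forall>X\<in>H. \<forall>P\<in>\<P>. integrable P X) \<and>
     (\<forall>X\<in>H. E X = (SUP P\<in>\<P>. integral\<^sup>L P X))"

definition lower_cap :: "'a measure set \<Rightarrow> 'a set \<Rightarrow> real" where
  "lower_cap \<P> A = (INF P\<in>\<P>. measure P A)"

definition upper_nn :: "'a measure set \<Rightarrow> ('a \<Rightarrow> real) \<Rightarrow> ennreal" where
  "upper_nn \<P> Y = (SUP P\<in>\<P>. \<integral>\<^sup>+ \<omega>. ennreal (Y \<omega>) \<partial>P)"

text \<open>Independence of a sequence (indexed from 0): X n is independent of
  (X 0, ..., X (n-1)) for every n.\<close>
definition indep_seq :: "(('a \<Rightarrow> real) \<Rightarrow> real) \<Rightarrow> (nat \<Rightarrow> 'a \<Rightarrow> real) \<Rightarrow> bool" where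
  "indep_seq E X \<longleftrightarrow>
     (\<forall>n \<phi>. bLip (Suc n) \<phi> \<longrightarrow>
        E (\<lambda>\<omega>. \<phi> (\<lambda>i. X i \<omega>)) =
        E (\<lambda>\<omega>. E (\<lambda>\<omega>'. \<phi> ((\<lambda>i. X i \<omega>)(n := X n \<omega>')))))"

definition condA :: "('a \<Rightarrow> real) set \<Rightarrow> (('a \<Rightarrow> real) \<Rightarrow> real) \<Rightarrow> bool" where
  "condA H E \<longleftrightarrow>
     (\<forall>X\<in>H. \<forall>fs::nat \<Rightarrow> real \<Rightarrow> real.
        (\<forall>n. bLip1 (fs n)) \<and> (\<forall>x. decseq (\<lambda>n. fs n x)) \<and> (\<forall>x. (\<lambda>n. fs n x) \<longlonglongrightarrow> 0)
        \<longrightarrow> (decseq (\<lambda>n. E (\<lambda>\<omega>. fs n (X \<omega>))) \<and> (\<lambda>n. E (\<lambda>\<omega>. fs n (X \<omega>))) \<longlonglongrightarrow> 0))"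

definition C12 :: "(real \<Rightarrow> real \<Rightarrow> real) \<Rightarrow> (real \<Rightarrow> real \<Rightarrow> real) \<Rightarrow> (real \<Rightarrow> real \<Rightarrow> real) \<Rightarrow> bool" where
  "C12 \<phi> \<phi>t \<phi>xx \<longleftrightarrow>
     (\<exists>\<phi>x. (\<forall>s>0. \<forall>y.
              ((\<lambda>r. \<phi> r y) has_real_derivative \<phi>t s y) (at s) \<and>
              ((\<lambda>z. \<phi> s z) has_real_derivative \<phi>x s y) (at y) \<and>
              ((\<lambda>z. \<phi>x s z) has_real_derivative \<phi>xx s y) (at y)) \<and>
           continuous_on ({0<..} \<times> UNIV) (\<lambda>(s,y). \<phi> s y) \<and>
           continuous_on ({0<..} \<times> UNIV) (\<lambda>(s,y). \<phi>t s y) \<and>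
           continuous_on ({0<..} \<times> UNIV) (\<lambda>(s,y). \<phi>x s y) \<and>
           continuous_on ({0<..} \<times> UNIV) (\<lambda>(s,y). \<phi>xx s y))"

definition visc_sub :: "(real \<Rightarrow> real) \<Rightarrow> (real \<Rightarrow> real \<Rightarrow> real) \<Rightarrow> bool" where
  "visc_sub G u \<longleftrightarrow>
     (\<forall>t x \<phi> \<phi>t \<phi>xx. t > 0 \<longrightarrow> C12 \<phi> \<phi>t \<phi>xx \<longrightarrow>
        (\<forall>s>0. \<forall>y. u s y \<le> \<phi> s y) \<longrightarrow> \<phi> t x = u t x \<longrightarrow>
        \<phi>t t x - G (\<phi>xx t x) \<le> 0)"

definition visc_super :: "(real \<Rightarrow> real) \<Rightarrow> (real \<Rightarrow> real \<Rightarrow> real) \<Rightarrow> bool" where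
  "visc_super G u \<longleftrightarrow>
     (\<forall>t x \<phi> \<phi>t \<phi>xx. t > 0 \<longrightarrow> C12 \<phi> \<phi>t \<phi>xx \<longrightarrow>
        (\<forall>s>0. \<forall>y. \<phi> s y \<le> u s y) \<longrightarrow> \<phi> t x = u t x \<longrightarrow>
        \<phi>t t x - G (\<phi>xx t x) \<ge> 0)"

definition visc_sol :: "(real \<Rightarrow> real) \<Rightarrow> (real \<Rightarrow> real \<Rightarrow> real) \<Rightarrow> bool" where
  "visc_sol G u \<longleftrightarrow>
     continuous_on ({0..} \<times> UNIV) (\<lambda>(t,x). u t x) \<and> visc_sub G u \<and> visc_super G u"

text \<open>Polynomial growth in x, locally uniformly in t (uniqueness class).\<close>
definition poly_growth :: "(real \<Rightarrow> real \<Rightarrow> real) \<Rightarrow> bool" where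
  "poly_growth v \<longleftrightarrow> (\<forall>T. \<exists>C (k::nat). \<forall>t\<in>{0..T}. \<forall>x. \<bar>v t x\<bar> \<le> C * (1 + \<bar>x\<bar> ^ k))"

definition G_normal :: "('b \<Rightarrow> real) set \<Rightarrow> (('b \<Rightarrow> real) \<Rightarrow> real) \<Rightarrow> ('b \<Rightarrow> real) \<Rightarrow> bool" where
  "G_normal Ht Et \<xi> \<longleftrightarrow>
     \<xi> \<in> Ht \<and> (\<lambda>\<omega>. (\<xi> \<omega>)\<^sup>2) \<in> Ht \<and>
     (let G = (\<lambda>a. 1/2 * Et (\<lambda>\<omega>. a * (\<xi> \<omega>)\<^sup>2)) in
      \<forall>f. bLip1 f \<longrightarrow>
        (let u = (\<lambda>t x. Et (\<lambda>\<omega>. f (x + sqrt t * \<xi> \<omega>))) in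
          visc_sol G u \<and> (\<forall>x. u 0 x = f x) \<and>
          (\<forall>v. visc_sol G v \<and> poly_growth v \<and> (\<forall>x. v 0 x = f x) \<longrightarrow>
               (\<forall>t\<ge>0. \<forall>x. v t x = u t x))))"

text \<open>Upper and lower standard deviations, sigma_i, B_n, S_n, W_n (0-indexed:
  X i stands for the paper's X_{i+1}; S n = X 0 + ... + X (n-1)).\<close>
definition sig_up :: "(('a \<Rightarrow> real) \<Rightarrow> real) \<Rightarrow> ('a \<Rightarrow> real) \<Rightarrow> real" where
  "sig_up E Y = sqrt (E (\<lambda>\<omega>. (Y \<omega>)\<^sup>2))"

definition sig_low :: "(('a \<Rightarrow> real) \<Rightarrow> real) \<Rightarrow> ('a \<Rightarrow> real) \<Rightarrow> real" where
  "sig_low E Y = sqrt (- E (\<lambda>\<omega>. - (Y \<omega>)\<^sup>2))"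

definition sig_mid :: "(('a \<Rightarrow> real) \<Rightarrow> real) \<Rightarrow> ('a \<Rightarrow> real) \<Rightarrow> real" where
  "sig_mid E Y = (sig_low E Y + sig_up E Y) / 2"

definition Bn :: "(('a \<Rightarrow> real) \<Rightarrow> real) \<Rightarrow> (nat \<Rightarrow> 'a \<Rightarrow> real) \<Rightarrow> nat \<Rightarrow> real" where
  "Bn E X n = sqrt (\<Sum>i<n. (sig_mid E (X i))\<^sup>2)"

definition Wn :: "(('a \<Rightarrow> real) \<Rightarrow> real) \<Rightarrow> (nat \<Rightarrow> 'a \<Rightarrow> real) \<Rightarrow> nat \<Rightarrow> 'a \<Rightarrow> real" where
  "Wn E X n \<omega> = (\<Sum>i<n. X i \<omega>) / Bn E X n"

definition seq_hyps :: "('a \<Rightarrow> real) set \<Rightarrow> (('a \<Rightarrow> real) \<Rightarrow> real) \<Rightarrow> real \<Rightarrow> (nat \<Rightarrow> 'a \<Rightarrow> real) \<Rightarrow> bool" where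
  "seq_hyps H E \<beta> X \<longleftrightarrow>
     (\<forall>i. X i \<in> H \<and> (\<lambda>\<omega>. (X i \<omega>)\<^sup>2) \<in> H) \<and>
     indep_seq E X \<and>
     (\<forall>i. E (X i) = 0 \<and> E (\<lambda>\<omega>. - X i \<omega>) = 0) \<and>
     (\<forall>i. sig_up E (X i) / sig_low E (X i) = \<beta>) \<and>
     (\<exists>c>0. \<forall>i. c \<le> (sig_low E (X i))\<^sup>2) \<and>
     (\<exists>C. \<forall>i. (sig_up E (X i))\<^sup>2 \<le> C)"

text \<open>alpha is a constant for which Song's convergence-rate theorem holds
  (for every sequence of the claim's kind in this space).\<close>
definition song_constant ::
  "'a measure set \<Rightarrow> ('a \<Rightarrow> real) set \<Rightarrow> (('a \<Rightarrow> real) \<Rightarrow> real) \<Rightarrow>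
   (('b \<Rightarrow> real) \<Rightarrow> real) \<Rightarrow> ('b \<Rightarrow> real) \<Rightarrow> real \<Rightarrow> real \<Rightarrow> bool" where
  "song_constant \<P> H E Et \<xi> \<beta> \<alpha> \<longleftrightarrow>
     (\<exists>C>0. \<forall>Y. seq_hyps H E \<beta> Y \<and>
                (SUP i. upper_nn \<P> (\<lambda>\<omega>. \<bar>Y i \<omega>\<bar> powr (2 + \<alpha>))) < \<infinity> \<longrightarrow>
        (\<forall>n\<ge>1. \<forall>g. bLip1 g \<and> (\<forall>x y. \<bar>g x - g y\<bar> \<le> \<bar>x - y\<bar>) \<longrightarrow>
           \<bar>E (\<lambda>\<omega>. g (Wn E Y n \<omega>)) - Et (\<lambda>\<omega>. g (\<xi> \<omega>))\<bar> \<le>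
           C * (MAX i\<in>{..<n}.
                  enn2real (upper_nn \<P> (\<lambda>\<omega>. \<bar>Y i \<omega>\<bar> powr (2 + \<alpha>)))
                    / sig_mid E (Y i) powr (2 + \<alpha>)
                  * (sig_mid E (Y i) / Bn E Y n) powr \<alpha>)))"

end

theory Submission
  imports Defs "HOL-Real_Asymp.Real_Asymp"
begin

text \<open>
  Let \<open>m\<close> be the common value of \<open>Et (f \<xi>)\<close> and \<open>- Et (- f \<xi>)\<close>, and put \<open>h = f - m\<close>. Song's theorem applied to
  \<open>h\<close> and \<open>- h\<close> bounds both \<open>E (h (W\<^sub>n))\<close> and \<open>E (- h (W\<^sub>n))\<close> by a multiple of \<open>n\<close> to the power
  \<open>- \<alpha> / 2\<close>; applied to the truncations \<open>min \<bar>x\<bar> N\<close> it bounds the first absolute moments of \<open>W\<^sub>n\<close>.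
  Since \<open>W\<^sub>l\<close> differs from \<open>(S\<^sub>l - S\<^sub>k) / B\<^sub>l\<close> by \<open>(B\<^sub>k / B\<^sub>l) W\<^sub>k\<close>, independence shows that under every
  single measure \<open>P\<close> of the family the covariance of \<open>h (W\<^sub>k)\<close> and \<open>h (W\<^sub>l)\<close>, for \<open>k \<le> l\<close>, is at most a
  multiple of \<open>(k / l)\<close> to the power \<open>\<alpha> / 2\<close>. Hence the second moment of the logarithmic average at
  \<open>n\<close> is of order \<open>1 / ln n\<close>, which is summable along \<open>n = 2 ^ (j\<^sup>2)\<close>; between consecutive such \<open>n\<close> the
  average varies little because \<open>h\<close> is bounded.
\<close>

subsection \<open>Logarithmic averages\<close>

text \<open>As the exponent \<open>a - 1\<close> is negative, the mean value theorem bounds the term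
  at \<open>k\<close> by \<open>(k powr a - (k - 1) powr a) / a\<close>, and these bounds
  telescope.\<close>

lemma sum_powr_le:
  fixes a :: real
  assumes "0 < a" "a < 1"
  shows "(\<Sum>k=1..n. real k powr (a - 1)) \<le> real n powr a / a"
proof (induction n)
  case (Suc n)
  \<comment> \<open>The interval from 0 to 1 is treated apart, since \<open>x powr a\<close> has no
    derivative at 0; there the claim is \<open>1 \<le> 1 / a\<close>.\<close>
  have "real (Suc n) powr (a - 1) \<le> (real (Suc n) powr a - real n powr a) / a"
  proof (cases "n = 0")
    case False
    have "\<exists>z. real n < z \<and> z < real (Suc n) \<and>
        real (Suc n) powr a - real n powr a = (real (Suc n) - real n) * (a * z powr (a - 1))"
      using False by (intro MVT2) (auto intro!: derivative_eq_intros simp: powr_diff)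
    then obtain z where z: "real n < z" "z < real (Suc n)"
      "real (Suc n) powr a - real n powr a = a * z powr (a - 1)" by auto
    have "real (Suc n) powr (a - 1) \<le> z powr (a - 1)"
      using z assms by (intro powr_mono2') auto
    then show ?thesis using z assms by simp
  qed (use assms in simp)
  then show ?case using Suc assms by (simp add: diff_divide_distrib)
qed simp

text \<open>The inequality \<open>ln x \<le> x - 1\<close> at \<open>x = n / (n + 1)\<close> bounds
  \<open>1 / (n + 1)\<close> by a difference of logarithms, and these telescope.\<close>

lemma sum_inverse_diff_le_ln:
  assumes "1 \<le> m" "m \<le> n"
  shows "(\<Sum>k=Suc m..n. 1 / real k) \<le> ln (real n) - ln (real m)"
  using assms(2)
proof (induction n rule: dec_induct)
  case (step n)
  have "ln (real n / real (Suc n)) \<le> real n / real (Suc n) - 1"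
    using step assms by (intro ln_le_minus_one) auto
  also have "\<dots> = - (1 / real (Suc n))" by (simp add: field_simps)
  finally have "1 / real (Suc n) \<le> ln (real (Suc n)) - ln (real n)"
    using step assms by (simp add: ln_div)
  then show ?case using step by simp
qed simp

text \<open>Harmonic numbers minus logarithms converge to the Euler-Mascheroni constant. The limit 1
  is what brings back the constant subtracted when \<open>f\<close> is centred.\<close>

lemma harmonic_sum_over_ln_tendsto: "(\<lambda>n. (\<Sum>k=1..n. 1 / real k) / ln (real n)) \<longlonglongrightarrow> 1"
proof -
  have "(\<lambda>n. (harm n - ln (real n)) * (1 / ln (real n)) + 1) \<longlonglongrightarrow> euler_mascheroni * 0 + (1 :: real)"
    by (intro tendsto_intros euler_mascheroni_LIMSEQ) real_asymp
  moreover have "\<forall>\<^sub>F n in sequentially. (harm n - ln (real n)) * (1 / ln (real n)) + 1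
      = (\<Sum>k=1..n. 1 / real k) / ln (real n)"
    using eventually_gt_at_top[of 1]
    by eventually_elim (simp add: harm_def field_simps)
  ultimately show ?thesis using Lim_transform_eventually by fastforce
qed

text \<open>Each \<open>n \<ge> 2\<close> lies between \<open>2 ^ (j\<^sup>2)\<close> and
  \<open>2 ^ ((j + 1)\<^sup>2)\<close> for some \<open>j \<ge> 1\<close>. From the left end to
  \<open>n\<close> the value of \<open>V\<close> moves by at most
  \<open>B * (2 * j + 1) * ln 2\<close>, which is negligible against \<open>ln n\<close>, of order
  \<open>j\<^sup>2\<close>.\<close>

lemma log_average_tendsto_0:
  fixes V :: "nat \<Rightarrow> real"
  assumes sub: "(\<lambda>j. V (2 ^ (j\<^sup>2)) / (real j)\<^sup>2) \<longlonglongrightarrow> 0"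
    and osc: "\<And>m n. 1 \<le> m \<Longrightarrow> m \<le> n \<Longrightarrow> \<bar>V n - V m\<bar> \<le> B * (ln (real n) - ln (real m))"
    and B: "0 \<le> B"
  shows "(\<lambda>n. V n / ln (real n)) \<longlonglongrightarrow> 0"
proof -
  \<comment> \<open>The floor makes \<open>j n\<close> the largest \<open>j\<close> with
    \<open>2 ^ (j\<^sup>2) \<le> n\<close>, for \<open>n \<ge> 1\<close>.\<close>
  define j where "j n = nat \<lfloor>sqrt (log 2 (real n))\<rfloor>" for n :: nat
  \<comment> \<open>The divisor \<open>ln 2\<close> appears because \<open>sub\<close> is normalised
    by \<open>j\<^sup>2\<close>, while the logarithm of \<open>2 ^ (j\<^sup>2)\<close> is
    \<open>j\<^sup>2 * ln 2\<close>.\<close>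
  define g where "g i = \<bar>V (2 ^ (i\<^sup>2)) / (real i)\<^sup>2\<bar> / ln 2 + B * ((2 * real i + 1) / (real i)\<^sup>2)" for i
  have "g \<longlonglongrightarrow> \<bar>0\<bar> / ln 2 + B * 0"
    unfolding g_def by (intro tendsto_intros sub) (auto, real_asymp)
  moreover have "filterlim j at_top at_top"
  proof -
    have "filterlim (\<lambda>n. nat \<lfloor>sqrt (log 2 (real n))\<rfloor>) at_top at_top"
      by (intro filterlim_compose[OF filterlim_nat_sequentially]
          filterlim_compose[OF filterlim_floor_sequentially]) real_asymp
    then show ?thesis by (simp add: j_def[abs_def])
  qed
  ultimately have lim: "(\<lambda>n. g (j n)) \<longlonglongrightarrow> 0"
    using filterlim_compose by fastforce
  have "\<bar>V n / ln (real n)\<bar> \<le> g (j n)" if n: "2 \<le> n" for n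
  proof -
    let ?j = "j n" and ?m = "2 ^ ((j n)\<^sup>2) :: nat"
    have l1: "1 \<le> log 2 (real n)" using n by simp
    then have s1: "1 \<le> sqrt (log 2 (real n))" by simp
    then have j1: "1 \<le> ?j" unfolding j_def by linarith
    have jle: "real ?j \<le> sqrt (log 2 (real n))" unfolding j_def using s1 by linarith
    have jgt: "sqrt (log 2 (real n)) < real ?j + 1" unfolding j_def using s1 by linarith
    have lo: "(real ?j)\<^sup>2 \<le> log 2 (real n)"
      using power_mono[OF jle, of 2] l1 by simp
    have hi: "log 2 (real n) \<le> (real ?j + 1)\<^sup>2"
      using jgt real_sqrt_le_iff by (metis less_imp_le sqrt_le_D)
    have lm: "ln (real ?m) = (real ?j)\<^sup>2 * ln 2" by (simp add: ln_realpow)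
    have ln_lo: "(real ?j)\<^sup>2 * ln 2 \<le> ln (real n)"
      using lo by (simp add: log_def field_simps)
    have ln_hi: "ln (real n) \<le> (real ?j + 1)\<^sup>2 * ln 2"
      using hi by (simp add: log_def field_simps)
    have "ln (real ?m) \<le> ln (real n)" using lm ln_lo by simp
    then have mn: "?m \<le> n" using n by (simp del: of_nat_power)
    have m1: "1 \<le> ?m" by simp
    have "\<bar>V n\<bar> \<le> \<bar>V ?m\<bar> + B * (ln (real n) - ln (real ?m))"
      using osc[OF m1 mn] by linarith
    also have "\<dots> \<le> \<bar>V ?m\<bar> + B * ((2 * real ?j + 1) * ln 2)"
      using ln_hi lm B by (intro add_left_mono mult_left_mono)
        (auto simp: power2_eq_square algebra_simps)
    finally have a: "\<bar>V n\<bar> \<le> \<bar>V ?m\<bar> + B * ((2 * real ?j + 1) * ln 2)" .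
    have pos: "0 < (real ?j)\<^sup>2 * ln 2" using j1 by simp
    have "\<bar>V n / ln (real n)\<bar> = \<bar>V n\<bar> / ln (real n)" using n by simp
    also have "\<dots> \<le> \<bar>V n\<bar> / ((real ?j)\<^sup>2 * ln 2)"
      using ln_lo pos by (intro divide_left_mono) auto
    also have "\<dots> \<le> (\<bar>V ?m\<bar> + B * ((2 * real ?j + 1) * ln 2)) / ((real ?j)\<^sup>2 * ln 2)"
      using a pos by (intro divide_right_mono) auto
    also have "\<dots> = g ?j" using j1 by (simp add: g_def field_simps)
    finally show ?thesis .
  qed
  then have "\<forall>\<^sub>F n in sequentially. norm (V n / ln (real n)) \<le> g (j n)"
    unfolding real_norm_def by (rule eventually_mono[OF eventually_ge_at_top[of 2]])
  then show ?thesis by (rule Lim_null_comparison[OF _ lim])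
qed

section \<open>Almost sure convergence under a single probability measure\<close>

context prob_space
begin

text \<open>The series of the squares has finite expectation, so it converges almost surely and its
  terms tend to zero.\<close>

lemma AE_tendsto_0_of_summable_second_moment:
  fixes Y :: "nat \<Rightarrow> 'a \<Rightarrow> real"
  assumes meas [measurable]: "\<And>j. Y j \<in> borel_measurable M"
    and int: "\<And>j. integrable M (\<lambda>\<omega>. (Y j \<omega>)\<^sup>2)"
    and bound: "\<And>j. expectation (\<lambda>\<omega>. (Y j \<omega>)\<^sup>2) \<le> c j" and c: "summable c"
  shows "AE \<omega> in M. (\<lambda>j. Y j \<omega>) \<longlonglongrightarrow> 0"
proof -
  have c0: "0 \<le> c j" for j
    by (rule order_trans[OF Bochner_Integration.integral_nonneg bound[of j]]) simp
  have "(\<integral>\<^sup>+\<omega>. (\<Sum>j. ennreal ((Y j \<omega>)\<^sup>2)) \<partial>M) = (\<Sum>j. \<integral>\<^sup>+\<omega>. ennreal ((Y j \<omega>)\<^sup>2) \<partial>M)"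
    by (intro nn_integral_suminf) measurable
  also have "\<dots> \<le> (\<Sum>j. ennreal (c j))"
    using bound int by (intro suminf_le) (auto simp: nn_integral_eq_integral ennreal_leI)
  also have "\<dots> = ennreal (\<Sum>j. c j)" using c c0 by (simp add: suminf_ennreal2)
  finally have "(\<integral>\<^sup>+\<omega>. (\<Sum>j. ennreal ((Y j \<omega>)\<^sup>2)) \<partial>M) \<noteq> \<infinity>"
    by (metis ennreal_less_top infinity_ennreal_def leD top.not_eq_extremum)
  then have "AE \<omega> in M. (\<Sum>j. ennreal ((Y j \<omega>)\<^sup>2)) \<noteq> \<infinity>"
    by (intro nn_integral_PInf_AE) auto
  then show ?thesis
  proof eventually_elim
    case (elim \<omega>)
    then have "summable (\<lambda>j. (Y j \<omega>)\<^sup>2)"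
      by (intro summable_suminf_not_top) (auto simp: top_ennreal_def)
    then have "(\<lambda>j. sqrt ((Y j \<omega>)\<^sup>2)) \<longlonglongrightarrow> sqrt 0"
      by (intro tendsto_real_sqrt summable_LIMSEQ_zero)
    then show ?case by (simp add: tendsto_rabs_zero_iff)
  qed
qed

lemma integrable_log_sum_square:
  fixes Z :: "nat \<Rightarrow> 'a \<Rightarrow> real"
  assumes [measurable]: "\<And>k. Z k \<in> borel_measurable M"
    and bdd: "\<And>k \<omega>. \<bar>Z k \<omega>\<bar> \<le> B"
  shows "integrable M (\<lambda>\<omega>. (\<Sum>k=1..n. Z k \<omega> / real k)\<^sup>2)"
proof -
  have "\<bar>\<Sum>k=1..n. Z k \<omega> / real k\<bar> \<le> (\<Sum>k=1..n. B / real k)" for \<omega>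
    by (rule order_trans[OF sum_abs]) (auto intro!: sum_mono divide_right_mono bdd)
  then show ?thesis
    by (intro integrable_const_bound[where B = "(\<Sum>k=1..n. B / real k)\<^sup>2"])
      (auto intro!: AE_I2 simp: abs_le_square_iff[symmetric] intro: order_trans[OF _ abs_ge_self])
qed

text \<open>Adding the term with index \<open>N = n + 1\<close> raises the second moment by at most
  the sum over \<open>k \<le> N\<close> of \<open>2 / (N * k) * C * (k / N) powr a\<close>, which
  \<open>sum_powr_le\<close> reduces to \<open>2 * C / a * (1 / N)\<close>. Upper bounds on the
  mixed moments suffice.\<close>

lemma second_moment_log_sum_le:
  fixes Z :: "nat \<Rightarrow> 'a \<Rightarrow> real"
  assumes [measurable]: "\<And>k. Z k \<in> borel_measurable M"
    and bdd: "\<And>k \<omega>. \<bar>Z k \<omega>\<bar> \<le> B"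
    and cov: "\<And>k l. 1 \<le> k \<Longrightarrow> k \<le> l \<Longrightarrow>
      expectation (\<lambda>\<omega>. Z k \<omega> * Z l \<omega>) \<le> C * (real k / real l) powr a"
    and a: "0 < a" "a < 1" and C: "0 \<le> C"
  shows "expectation (\<lambda>\<omega>. (\<Sum>k=1..n. Z k \<omega> / real k)\<^sup>2) \<le> 2 * C / a * (\<Sum>k=1..n. 1 / real k)"
proof (induction n)
  case (Suc n)
  let ?V = "\<lambda>n \<omega>. \<Sum>k=1..n. Z k \<omega> / real k"
  let ?N = "real (Suc n)"
  have int: "integrable M (\<lambda>\<omega>. Z k \<omega> * Z l \<omega>)" for k l
    by (intro integrable_const_bound[where B = "B * B"])
      (auto simp: abs_mult intro!: AE_I2 mult_mono bdd order_trans[OF abs_ge_zero bdd])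
  note intV = integrable_log_sum_square[of Z, OF assms(1) bdd, of n]
  have ex: "(?V (Suc n) \<omega>)\<^sup>2 \<le> (?V n \<omega>)\<^sup>2 + (\<Sum>k=1..Suc n. 2 / (?N * real k) * (Z k \<omega> * Z (Suc n) \<omega>))"
    for \<omega>
  proof -
    have "(\<Sum>k=1..Suc n. 2 / (?N * real k) * (Z k \<omega> * Z (Suc n) \<omega>))
        = 2 * (Z (Suc n) \<omega> / ?N) * ?V (Suc n) \<omega>"
      unfolding sum_distrib_left by (intro sum.cong) (auto simp: field_simps)
    moreover have "?V (Suc n) \<omega> = ?V n \<omega> + Z (Suc n) \<omega> / ?N" by simp
    \<comment> \<open>The two sides differ by \<open>z\<^sup>2\<close>: the diagonal term is counted
      twice, so that every index up to and including \<open>Suc n\<close> falls under the one bound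
      \<open>cov\<close>.\<close>
    moreover have "(v + z)\<^sup>2 \<le> v\<^sup>2 + 2 * z * (v + z)" for v z :: real
      by (simp add: power2_eq_square algebra_simps)
    ultimately show ?thesis by metis
  qed
  have "expectation (\<lambda>\<omega>. (?V (Suc n) \<omega>)\<^sup>2)
      \<le> expectation (\<lambda>\<omega>. (?V n \<omega>)\<^sup>2 + (\<Sum>k=1..Suc n. 2 / (?N * real k) * (Z k \<omega> * Z (Suc n) \<omega>)))"
    by (intro integral_mono ex integrable_log_sum_square[OF assms(1) bdd] Bochner_Integration.integrable_add
        Bochner_Integration.integrable_sum integrable_mult_right int)
  also have "\<dots> = expectation (\<lambda>\<omega>. (?V n \<omega>)\<^sup>2)
      + (\<Sum>k=1..Suc n. 2 / (?N * real k) * expectation (\<lambda>\<omega>. Z k \<omega> * Z (Suc n) \<omega>))"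
    using intV int by (simp del: sum.cl_ivl_Suc)
  also have "(\<Sum>k=1..Suc n. 2 / (?N * real k) * expectation (\<lambda>\<omega>. Z k \<omega> * Z (Suc n) \<omega>))
      \<le> (\<Sum>k=1..Suc n. 2 / (?N * real k) * (C * (real k / ?N) powr a))"
    by (intro sum_mono mult_left_mono cov) auto
  also have "\<dots> = 2 * C / (?N * ?N powr a) * (\<Sum>k=1..Suc n. real k powr (a - 1))"
    unfolding sum_distrib_left
    by (intro sum.cong) (auto simp: powr_divide powr_diff field_simps)
  also have "\<dots> \<le> 2 * C / (?N * ?N powr a) * (?N powr a / a)"
    using C by (intro mult_left_mono sum_powr_le a) auto
  also have "\<dots> = 2 * C / a * (1 / ?N)"
    using powr_gt_zero[of ?N a] by (simp del: powr_gt_zero of_nat_Suc)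
  finally show ?case using Suc by (simp add: distrib_left)
qed simp

text \<open>At \<open>2 ^ (j\<^sup>2)\<close> the second moment of the sum is of order
  \<open>j\<^sup>2\<close>, hence of summable order \<open>1 / j\<^sup>2\<close> once the sum is
  divided by \<open>j\<^sup>2\<close>. Boundedness of \<open>Z\<close> gives the oscillation bound
  between these indices.\<close>

lemma log_average_tendsto_0_of_cov_decay:
  fixes Z :: "nat \<Rightarrow> 'a \<Rightarrow> real"
  assumes [measurable]: "\<And>k. Z k \<in> borel_measurable M"
    and bdd: "\<And>k \<omega>. \<bar>Z k \<omega>\<bar> \<le> B"
    and cov: "\<And>k l. 1 \<le> k \<Longrightarrow> k \<le> l \<Longrightarrow>
      expectation (\<lambda>\<omega>. Z k \<omega> * Z l \<omega>) \<le> C * (real k / real l) powr a"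
    and a: "0 < a" "a < 1" and C: "0 \<le> C"
  shows "AE \<omega> in M. (\<lambda>n. (\<Sum>k=1..n. Z k \<omega> / real k) / ln (real n)) \<longlonglongrightarrow> 0"
proof -
  let ?V = "\<lambda>n \<omega>. \<Sum>k=1..n. Z k \<omega> / real k"
  let ?Y = "\<lambda>j \<omega>. ?V (2 ^ (j\<^sup>2)) \<omega> / (real j)\<^sup>2"
  have B: "0 \<le> B" using bdd[of 0 undefined] by linarith
  have harm: "(\<Sum>k=1..n. 1 / real k) \<le> 1 + ln (real n)" if "1 \<le> n" for n
    using sum_inverse_diff_le_ln[of 1 n] that by (simp add: sum.atLeast_Suc_atMost)
  note intV = integrable_log_sum_square[of Z, OF assms(1) bdd]
  \<comment> \<open>For \<open>j = 0\<close> both sides vanish by the convention for division by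
    zero. For \<open>j \<ge> 1\<close> the factor 2 of \<open>second_moment_log_sum_le\<close> is
    doubled by \<open>1 + j\<^sup>2 * ln 2 \<le> 2 * j\<^sup>2\<close>.\<close>
  have bound: "expectation (\<lambda>\<omega>. (?Y j \<omega>)\<^sup>2) \<le> 4 * C / a * (1 / (real j)\<^sup>2)" for j
  proof (cases "j = 0")
    case False
    then have j: "1 \<le> j" by simp
    have "expectation (\<lambda>\<omega>. (?V (2 ^ (j\<^sup>2)) \<omega>)\<^sup>2) \<le> 2 * C / a * (\<Sum>k=1..2 ^ (j\<^sup>2). 1 / real k)"
      by (rule second_moment_log_sum_le[OF assms(1) bdd cov a C])
    also have "\<dots> \<le> 2 * C / a * (1 + ln (real (2 ^ (j\<^sup>2))))"
      using a C by (intro mult_left_mono harm) auto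
    also have "ln (real (2 ^ (j\<^sup>2))) = (real j)\<^sup>2 * ln 2" by (simp add: ln_realpow)
    also have "2 * C / a * (1 + (real j)\<^sup>2 * ln 2) \<le> 2 * C / a * (2 * (real j)\<^sup>2)"
    proof (intro mult_left_mono)
      have "(real j)\<^sup>2 * ln 2 \<le> (real j)\<^sup>2 * 1" using ln_2_less_1 by (intro mult_left_mono) auto
      moreover have "1 \<le> (real j)\<^sup>2" using j by simp
      ultimately show "1 + (real j)\<^sup>2 * ln 2 \<le> 2 * (real j)\<^sup>2" by linarith
    qed (use a C in auto)
    finally have *: "expectation (\<lambda>\<omega>. (?V (2 ^ (j\<^sup>2)) \<omega>)\<^sup>2) \<le> 4 * C / a * (real j)\<^sup>2" by simp
    have "expectation (\<lambda>\<omega>. (?Y j \<omega>)\<^sup>2) = expectation (\<lambda>\<omega>. (?V (2 ^ (j\<^sup>2)) \<omega>)\<^sup>2) / ((real j)\<^sup>2)\<^sup>2"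
      by (simp add: power_divide)
    also have "\<dots> \<le> 4 * C / a * (real j)\<^sup>2 / ((real j)\<^sup>2)\<^sup>2"
      using * by (intro divide_right_mono) auto
    also have "\<dots> = 4 * C / a * (1 / (real j)\<^sup>2)" using j by (simp add: field_simps power2_eq_square)
    finally show ?thesis .
  qed simp
  have "summable (\<lambda>j. 4 * C / a * (1 / (real j)\<^sup>2))"
    using inverse_power_summable[of 2, where 'a = real]
    by (intro summable_mult) (simp add: inverse_eq_divide)
  moreover have "integrable M (\<lambda>\<omega>. (?Y j \<omega>)\<^sup>2)" for j
    unfolding power_divide by (intro integrable_divide_zero intV)
  ultimately have "AE \<omega> in M. (\<lambda>j. ?Y j \<omega>) \<longlonglongrightarrow> 0"
    by (intro AE_tendsto_0_of_summable_second_moment[OF _ _ bound]) auto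
  then show ?thesis
  proof eventually_elim
    case (elim \<omega>)
    show ?case
    proof (rule log_average_tendsto_0[OF elim _ B])
      fix m n :: nat assume mn: "1 \<le> m" "m \<le> n"
      have "?V n \<omega> = ?V m \<omega> + (\<Sum>k=Suc m..n. Z k \<omega> / real k)"
        using sum.ub_add_nat[of 1 m "\<lambda>k. Z k \<omega> / real k" "n - m"] mn by simp
      then have "\<bar>?V n \<omega> - ?V m \<omega>\<bar> \<le> (\<Sum>k=Suc m..n. \<bar>Z k \<omega> / real k\<bar>)"
        using sum_abs[of "\<lambda>k. Z k \<omega> / real k"] by simp
      also have "\<dots> \<le> (\<Sum>k=Suc m..n. B * (1 / real k))"
        by (intro sum_mono) (auto intro!: divide_right_mono bdd)
      also have "\<dots> \<le> B * (ln (real n) - ln (real m))"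
        unfolding sum_distrib_left[symmetric]
        by (intro mult_left_mono sum_inverse_diff_le_ln mn B)
      finally show "\<bar>?V n \<omega> - ?V m \<omega>\<bar> \<le> B * (ln (real n) - ln (real m))" .
    qed
  qed
qed

end

subsection \<open>Bounded Lipschitz functions\<close>

text \<open>Strictly positive constants are chosen so that the rescaling by \<open>1 / L\<close> and
  the truncation level \<open>2 * B / r\<close> make sense later.\<close>

lemma bLip1_pos_bounds:
  assumes "bLip1 f"
  obtains B L where "0 < B" "0 < L" "\<And>x. \<bar>f x\<bar> \<le> B" "\<And>x y. \<bar>f x - f y\<bar> \<le> L * \<bar>x - y\<bar>"
proof -
  obtain B L where B: "\<And>x. \<bar>f x\<bar> \<le> B" and L: "\<And>x y. \<bar>f x - f y\<bar> \<le> L * \<bar>x - y\<bar>"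
    using assms unfolding bLip1_def by auto
  have "\<bar>f x\<bar> \<le> max B 1" "\<bar>f x - f y\<bar> \<le> max L 1 * \<bar>x - y\<bar>" for x y
    using B[of x] order_trans[OF L[of x y] mult_right_mono[of L "max L 1"]] by auto
  then show ?thesis using that[of "max B 1" "max L 1"] by auto
qed

lemma bLip_pos_bounds:
  assumes "bLip n \<phi>"
  obtains B L where "0 < B" "0 < L" "\<And>x. \<bar>\<phi> x\<bar> \<le> B"
    "\<And>x y. \<bar>\<phi> x - \<phi> y\<bar> \<le> L * (\<Sum>i<n. \<bar>x i - y i\<bar>)"
proof -
  obtain B L where B: "\<And>x. \<bar>\<phi> x\<bar> \<le> B"
    and L: "\<And>x y. \<bar>\<phi> x - \<phi> y\<bar> \<le> L * (\<Sum>i<n. \<bar>x i - y i\<bar>)"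
    using assms unfolding bLip_def by auto
  have "\<bar>\<phi> x\<bar> \<le> max B 1" "\<bar>\<phi> x - \<phi> y\<bar> \<le> max L 1 * (\<Sum>i<n. \<bar>x i - y i\<bar>)" for x y
    using B[of x] order_trans[OF L[of x y] mult_right_mono[of L "max L 1"]]
    by (auto simp: sum_nonneg)
  then show ?thesis using that[of "max B 1" "max L 1"] by auto
qed

lemma bLipI:
  assumes "\<And>x y. (\<And>i. i < n \<Longrightarrow> x i = y i) \<Longrightarrow> \<phi> x = \<phi> y"
    and "\<And>x. \<bar>\<phi> x\<bar> \<le> B" and "\<And>x y. \<bar>\<phi> x - \<phi> y\<bar> \<le> L * (\<Sum>i<n. \<bar>x i - y i\<bar>)"
  shows "bLip n \<phi>"
  unfolding bLip_def
proof (intro conjI allI impI exI)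
  fix x y :: "nat \<Rightarrow> real" assume "\<forall>i<n. x i = y i"
  then show "\<phi> x = \<phi> y" using assms(1) by blast
qed (rule assms(2) assms(3))+

lemma bLip_cong: "bLip n \<phi> \<Longrightarrow> (\<And>i. i < n \<Longrightarrow> x i = y i) \<Longrightarrow> \<phi> x = \<phi> y"
  unfolding bLip_def by blast

lemma bLip_const: "bLip n (\<lambda>_. c)"
  by (rule bLipI[where B = "\<bar>c\<bar>" and L = 0]) auto

lemma bLip_mono:
  assumes "bLip m \<phi>" "m \<le> n"
  shows "bLip n \<phi>"
proof -
  obtain B L where *: "0 < B" "0 < L" "\<And>x. \<bar>\<phi> x\<bar> \<le> B"
    "\<And>x y. \<bar>\<phi> x - \<phi> y\<bar> \<le> L * (\<Sum>i<m. \<bar>x i - y i\<bar>)"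
    using bLip_pos_bounds[OF assms(1)] by blast
  have "(\<Sum>i<m. \<bar>x i - y i\<bar>) \<le> (\<Sum>i<n. \<bar>x i - y i\<bar>)" for x y :: "nat \<Rightarrow> real"
    using assms by (intro sum_mono2) auto
  then have "\<bar>\<phi> x - \<phi> y\<bar> \<le> L * (\<Sum>i<n. \<bar>x i - y i\<bar>)" for x y
    using *(2) order_trans[OF *(4) mult_left_mono] by force
  then show ?thesis
    using *(3) assms(2) by (intro bLipI[where B = B and L = L] bLip_cong[OF assms(1)]) auto
qed

lemma bLip_add:
  assumes "bLip n \<phi>" "bLip n \<psi>"
  shows "bLip n (\<lambda>x. \<phi> x + \<psi> x)"
proof -
  obtain B L where 1: "0 < B" "0 < L" "\<And>x. \<bar>\<phi> x\<bar> \<le> B"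
    "\<And>x y. \<bar>\<phi> x - \<phi> y\<bar> \<le> L * (\<Sum>i<n. \<bar>x i - y i\<bar>)"
    using bLip_pos_bounds[OF assms(1)] by blast
  obtain B' L' where 2: "0 < B'" "0 < L'" "\<And>x. \<bar>\<psi> x\<bar> \<le> B'"
    "\<And>x y. \<bar>\<psi> x - \<psi> y\<bar> \<le> L' * (\<Sum>i<n. \<bar>x i - y i\<bar>)"
    using bLip_pos_bounds[OF assms(2)] by blast
  show ?thesis
  proof (rule bLipI[where B = "B + B'" and L = "L + L'"])
    fix x y
    show "\<bar>\<phi> x + \<psi> x - (\<phi> y + \<psi> y)\<bar> \<le> (L + L') * (\<Sum>i<n. \<bar>x i - y i\<bar>)"
      using 1(4)[of x y] 2(4)[of x y] by (simp add: distrib_right)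
    show "\<bar>\<phi> x + \<psi> x\<bar> \<le> B + B'" using 1(3)[of x] 2(3)[of x] by linarith
  next
    fix x y :: "nat \<Rightarrow> real" assume "\<And>i. i < n \<Longrightarrow> x i = y i"
    then show "\<phi> x + \<psi> x = \<phi> y + \<psi> y"
      using bLip_cong[OF assms(1)] bLip_cong[OF assms(2)] by metis
  qed
qed

lemma bLip_mult:
  assumes "bLip n \<phi>" "bLip n \<psi>"
  shows "bLip n (\<lambda>x. \<phi> x * \<psi> x)"
proof -
  obtain B L where 1: "0 < B" "0 < L" "\<And>x. \<bar>\<phi> x\<bar> \<le> B"
    "\<And>x y. \<bar>\<phi> x - \<phi> y\<bar> \<le> L * (\<Sum>i<n. \<bar>x i - y i\<bar>)"
    using bLip_pos_bounds[OF assms(1)] by blast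
  obtain B' L' where 2: "0 < B'" "0 < L'" "\<And>x. \<bar>\<psi> x\<bar> \<le> B'"
    "\<And>x y. \<bar>\<psi> x - \<psi> y\<bar> \<le> L' * (\<Sum>i<n. \<bar>x i - y i\<bar>)"
    using bLip_pos_bounds[OF assms(2)] by blast
  show ?thesis
  proof (rule bLipI[where B = "B * B'" and L = "B * L' + L * B'"])
    fix x y :: "nat \<Rightarrow> real"
    let ?s = "\<Sum>i<n. \<bar>x i - y i\<bar>"
    have "\<bar>\<phi> x * \<psi> x - \<phi> y * \<psi> y\<bar> = \<bar>\<phi> x * (\<psi> x - \<psi> y) + (\<phi> x - \<phi> y) * \<psi> y\<bar>"
      by (simp add: algebra_simps)
    also have "\<dots> \<le> \<bar>\<phi> x\<bar> * \<bar>\<psi> x - \<psi> y\<bar> + \<bar>\<phi> x - \<phi> y\<bar> * \<bar>\<psi> y\<bar>"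
      by (metis abs_mult abs_triangle_ineq)
    also have "\<dots> \<le> B * (L' * ?s) + (L * ?s) * B'"
      using 1 2 by (intro add_mono mult_mono) (auto simp: sum_nonneg less_imp_le)
    finally show "\<bar>\<phi> x * \<psi> x - \<phi> y * \<psi> y\<bar> \<le> (B * L' + L * B') * ?s"
      by (simp add: algebra_simps)
    show "\<bar>\<phi> x * \<psi> x\<bar> \<le> B * B'"
      using 1 2 unfolding abs_mult by (intro mult_mono) (auto intro: less_imp_le)
  next
    fix x y :: "nat \<Rightarrow> real" assume "\<And>i. i < n \<Longrightarrow> x i = y i"
    then show "\<phi> x * \<psi> x = \<phi> y * \<psi> y"
      using bLip_cong[OF assms(1)] bLip_cong[OF assms(2)] by metis
  qed
qed

text \<open>The index set \<open>I\<close> is kept general to serve initial sums, blocks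
  \<open>{k..<l}\<close> of later terms and single coordinates alike. The case \<open>c = 0\<close>
  is covered by the convention for division by zero.\<close>

lemma bLip_comp_sum:
  assumes "bLip1 g" "I \<subseteq> {..<n}"
  shows "bLip n (\<lambda>x. g ((\<Sum>i\<in>I. x i) / c))"
proof -
  obtain B L where *: "0 < B" "0 < L" "\<And>x. \<bar>g x\<bar> \<le> B" "\<And>x y. \<bar>g x - g y\<bar> \<le> L * \<bar>x - y\<bar>"
    using bLip1_pos_bounds[OF assms(1)] by blast
  show ?thesis
  proof (rule bLipI[where B = B and L = "L / \<bar>c\<bar>"])
    fix x y :: "nat \<Rightarrow> real"
    have "\<bar>(\<Sum>i\<in>I. x i) / c - (\<Sum>i\<in>I. y i) / c\<bar> = \<bar>\<Sum>i\<in>I. x i - y i\<bar> / \<bar>c\<bar>"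
      by (simp add: sum_subtractf diff_divide_distrib[symmetric])
    also have "\<dots> \<le> (\<Sum>i<n. \<bar>x i - y i\<bar>) / \<bar>c\<bar>"
      using assms(2) by (intro divide_right_mono order_trans[OF sum_abs] sum_mono2) auto
    finally have "L * \<bar>(\<Sum>i\<in>I. x i) / c - (\<Sum>i\<in>I. y i) / c\<bar> \<le> L * ((\<Sum>i<n. \<bar>x i - y i\<bar>) / \<bar>c\<bar>)"
      using * by (intro mult_left_mono) auto
    then show "\<bar>g ((\<Sum>i\<in>I. x i) / c) - g ((\<Sum>i\<in>I. y i) / c)\<bar> \<le> L / \<bar>c\<bar> * (\<Sum>i<n. \<bar>x i - y i\<bar>)"
      using *(4)[of "(\<Sum>i\<in>I. x i) / c" "(\<Sum>i\<in>I. y i) / c"] by simp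
  next
    fix x y :: "nat \<Rightarrow> real" assume "\<And>i. i < n \<Longrightarrow> x i = y i"
    then have "(\<Sum>i\<in>I. x i) = (\<Sum>i\<in>I. y i)" using assms(2) by (intro sum.cong) auto
    then show "g ((\<Sum>i\<in>I. x i) / c) = g ((\<Sum>i\<in>I. y i) / c)" by simp
  qed (rule *(3))
qed

text \<open>Truncation makes the absolute value bounded, and its Lipschitz constant 1 does not
  depend on \<open>N\<close>, so moment bounds obtained from it are uniform in
  \<open>N\<close>.\<close>

lemma bLip1_min_abs: "0 \<le> N \<Longrightarrow> bLip1 (\<lambda>x. min \<bar>x\<bar> N)"
  unfolding bLip1_def by (intro conjI exI[of _ N] exI[of _ 1]) auto

lemma bLip1_diff_const:
  assumes "bLip1 f"
  shows "bLip1 (\<lambda>x. f x - m)"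
proof -
  obtain B L where *: "0 < B" "0 < L" "\<And>x. \<bar>f x\<bar> \<le> B" "\<And>x y. \<bar>f x - f y\<bar> \<le> L * \<bar>x - y\<bar>"
    using bLip1_pos_bounds[OF assms] by blast
  have "\<bar>f x - m\<bar> \<le> B + \<bar>m\<bar>" for x using *(3)[of x] by linarith
  then show ?thesis using *(4) unfolding bLip1_def by auto
qed

lemma bLip1_cmult:
  assumes "bLip1 f"
  shows "bLip1 (\<lambda>x. c * f x)"
proof -
  obtain B L where *: "0 < B" "0 < L" "\<And>x. \<bar>f x\<bar> \<le> B" "\<And>x y. \<bar>f x - f y\<bar> \<le> L * \<bar>x - y\<bar>"
    using bLip1_pos_bounds[OF assms] by blast
  have "\<bar>c * f x\<bar> \<le> \<bar>c\<bar> * B" "\<bar>c * f x - c * f y\<bar> \<le> (\<bar>c\<bar> * L) * \<bar>x - y\<bar>" for x y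
    using mult_left_mono[OF *(3)[of x], of "\<bar>c\<bar>"] mult_left_mono[OF *(4)[of x y], of "\<bar>c\<bar>"]
    by (auto simp: abs_mult right_diff_distrib[symmetric] mult.assoc)
  then show ?thesis unfolding bLip1_def by blast
qed

subsection \<open>Sublinear expectations and independence\<close>

locale sublinear =
  fixes M :: "'a measure" and H :: "('a \<Rightarrow> real) set" and E :: "('a \<Rightarrow> real) \<Rightarrow> real"
  assumes sublinear_expectation: "sublinear_expectation M H E"
begin

lemma measurable_H: "X \<in> H \<Longrightarrow> X \<in> borel_measurable M"
  and add_in_H: "X \<in> H \<Longrightarrow> Y \<in> H \<Longrightarrow> (\<lambda>\<omega>. X \<omega> + Y \<omega>) \<in> H"
  and cmult_in_H: "X \<in> H \<Longrightarrow> (\<lambda>\<omega>. c * X \<omega>) \<in> H"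
  and bLip_in_H: "(\<And>i. i < n \<Longrightarrow> Z i \<in> H) \<Longrightarrow> bLip n \<phi> \<Longrightarrow> (\<lambda>\<omega>. \<phi> (\<lambda>i. Z i \<omega>)) \<in> H"
  and E_mono: "X \<in> H \<Longrightarrow> Y \<in> H \<Longrightarrow> (\<And>\<omega>. X \<omega> \<le> Y \<omega>) \<Longrightarrow> E X \<le> E Y"
  and E_const: "E (\<lambda>\<omega>. c) = c"
  and E_add: "X \<in> H \<Longrightarrow> Y \<in> H \<Longrightarrow> E (\<lambda>\<omega>. X \<omega> + Y \<omega>) \<le> E X + E Y"
  and E_cmult: "0 \<le> c \<Longrightarrow> X \<in> H \<Longrightarrow> E (\<lambda>\<omega>. c * X \<omega>) = c * E X"
proof -
  note props = sublinear_expectation[unfolded sublinear_expectation_def]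
  show "X \<in> H \<Longrightarrow> X \<in> borel_measurable M"
    by (rule props[THEN conjunct1, rule_format])
  note props = props[THEN conjunct2]
  show "X \<in> H \<Longrightarrow> Y \<in> H \<Longrightarrow> (\<lambda>\<omega>. X \<omega> + Y \<omega>) \<in> H"
    by (rule props[THEN conjunct1, rule_format])
  note props = props[THEN conjunct2]
  show "X \<in> H \<Longrightarrow> (\<lambda>\<omega>. c * X \<omega>) \<in> H"
    by (rule props[THEN conjunct1, rule_format])
  note props = props[THEN conjunct2]
  show "(\<And>i. i < n \<Longrightarrow> Z i \<in> H) \<Longrightarrow> bLip n \<phi> \<Longrightarrow> (\<lambda>\<omega>. \<phi> (\<lambda>i. Z i \<omega>)) \<in> H"
    by (rule props[THEN conjunct1, rule_format])
  note props = props[THEN conjunct2]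
  show "X \<in> H \<Longrightarrow> Y \<in> H \<Longrightarrow> (\<And>\<omega>. X \<omega> \<le> Y \<omega>) \<Longrightarrow> E X \<le> E Y"
    by (rule props[THEN conjunct1, rule_format])
  note props = props[THEN conjunct2]
  show "E (\<lambda>\<omega>. c) = c"
    by (rule props[THEN conjunct1, rule_format])
  note props = props[THEN conjunct2]
  show "X \<in> H \<Longrightarrow> Y \<in> H \<Longrightarrow> E (\<lambda>\<omega>. X \<omega> + Y \<omega>) \<le> E X + E Y"
    by (rule props[THEN conjunct1, rule_format])
  show "0 \<le> c \<Longrightarrow> X \<in> H \<Longrightarrow> E (\<lambda>\<omega>. c * X \<omega>) = c * E X"
    by (rule props[THEN conjunct2, rule_format])
qed

text \<open>A constant is a bounded Lipschitz function of zero variables.\<close>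

lemma const_in_H: "(\<lambda>\<omega>. c) \<in> H"
  using bLip_in_H[of 0 "\<lambda>_ _. 0" "\<lambda>_. c"] bLip_const by simp

lemma uminus_in_H: "X \<in> H \<Longrightarrow> (\<lambda>\<omega>. - X \<omega>) \<in> H"
  using cmult_in_H[of X "-1"] by simp

lemma bLip1_in_H:
  assumes "bLip1 g" "X \<in> H"
  shows "(\<lambda>\<omega>. g (X \<omega>)) \<in> H"
  using bLip_in_H[of 1 "\<lambda>_. X" "\<lambda>x. g ((\<Sum>i\<in>{0}. x i) / 1)"] bLip_comp_sum[OF assms(1), of "{0}" 1 1] assms(2)
  by simp

lemma E_le_add:
  assumes "X \<in> H" "Y \<in> H" "Z \<in> H" "\<And>\<omega>. X \<omega> \<le> Y \<omega> + Z \<omega>"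
  shows "E X \<le> E Y + E Z"
  using E_mono[OF assms(1) add_in_H[OF assms(2,3)] assms(4)] E_add[OF assms(2,3)] by linarith

lemma abs_E_diff_le:
  assumes "X \<in> H" "Y \<in> H" "\<And>\<omega>. \<bar>X \<omega> - Y \<omega>\<bar> \<le> c"
  shows "\<bar>E X - E Y\<bar> \<le> c"
proof -
  have "X \<omega> \<le> Y \<omega> + c" "Y \<omega> \<le> X \<omega> + c" for \<omega> using assms(3)[of \<omega>] by linarith+
  then have "E X \<le> E Y + c" "E Y \<le> E X + c"
    using E_le_add[OF assms(1,2) const_in_H[of c]] E_le_add[OF assms(2,1) const_in_H[of c]]
    by (auto simp: E_const)
  then show ?thesis by linarith
qed

lemma E_bounds:
  assumes "X \<in> H" "\<And>\<omega>. \<bar>X \<omega>\<bar> \<le> c"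
  shows "\<bar>E X\<bar> \<le> c"
  using abs_E_diff_le[OF assms(1) const_in_H[of 0]] assms(2) by (simp add: E_const)

text \<open>Sub-additivity makes both values at most 0, while their sum is at least
  \<open>E 0 = 0\<close>.\<close>

lemma E_centered_eq_0:
  assumes "X \<in> H" "E X = m" "E (\<lambda>\<omega>. - X \<omega>) = - m"
  shows "E (\<lambda>\<omega>. X \<omega> - m) = 0" "E (\<lambda>\<omega>. - (X \<omega> - m)) = 0"
proof -
  have inH: "(\<lambda>\<omega>. X \<omega> - m) \<in> H" using add_in_H[OF assms(1) const_in_H[of "- m"]] by simp
  have "E (\<lambda>\<omega>. X \<omega> - m) \<le> 0"
    using E_le_add[OF inH assms(1) const_in_H[of "-m"]] assms(2) by (simp add: E_const)
  moreover have "E (\<lambda>\<omega>. - (X \<omega> - m)) \<le> 0"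
    using E_le_add[OF uminus_in_H[OF inH] uminus_in_H[OF assms(1)] const_in_H[of m]] assms(3)
    by (simp add: E_const)
  moreover have "0 \<le> E (\<lambda>\<omega>. X \<omega> - m) + E (\<lambda>\<omega>. - (X \<omega> - m))"
    using E_le_add[OF const_in_H[of 0] inH uminus_in_H[OF inH]] by (simp add: E_const)
  ultimately show "E (\<lambda>\<omega>. X \<omega> - m) = 0" "E (\<lambda>\<omega>. - (X \<omega> - m)) = 0" by linarith+
qed

lemma bLip_section_in_H:
  assumes "bLip (Suc n) \<phi>" "Y \<in> H"
  shows "(\<lambda>\<omega>. \<phi> (x(n := Y \<omega>))) \<in> H"
proof -
  obtain B L where *: "0 < B" "0 < L" "\<And>x. \<bar>\<phi> x\<bar> \<le> B"
    "\<And>x y. \<bar>\<phi> x - \<phi> y\<bar> \<le> L * (\<Sum>i<Suc n. \<bar>x i - y i\<bar>)"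
    using bLip_pos_bounds[OF assms(1)] by blast
  have "\<bar>\<phi> (x(n := s)) - \<phi> (x(n := t))\<bar> \<le> L * \<bar>s - t\<bar>" for s t
    using *(4)[of "x(n := s)" "x(n := t)"] by simp
  then have "bLip1 (\<lambda>s. \<phi> (x(n := s)))" using *(3) unfolding bLip1_def by blast
  then show ?thesis using assms(2) by (rule bLip1_in_H)
qed

text \<open>A sublinear expectation is 1-Lipschitz for the supremum norm, so integrating out one
  coordinate keeps the constants \<open>B\<close> and \<open>L\<close>. This lets independence be
  applied repeatedly.\<close>

lemma bLip_partial_E:
  assumes "bLip (Suc n) \<phi>" "Y \<in> H"
  shows "bLip n (\<lambda>x. E (\<lambda>\<omega>. \<phi> (x(n := Y \<omega>))))"
proof -
  obtain B L where *: "0 < B" "0 < L" "\<And>x. \<bar>\<phi> x\<bar> \<le> B"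
    "\<And>x y. \<bar>\<phi> x - \<phi> y\<bar> \<le> L * (\<Sum>i<Suc n. \<bar>x i - y i\<bar>)"
    using bLip_pos_bounds[OF assms(1)] by blast
  note inH = bLip_section_in_H[OF assms]
  show ?thesis
  proof (rule bLipI[where B = B and L = L])
    fix x y :: "nat \<Rightarrow> real" assume "\<And>i. i < n \<Longrightarrow> x i = y i"
    then have "\<phi> (x(n := Y \<omega>)) = \<phi> (y(n := Y \<omega>))" for \<omega>
      by (intro bLip_cong[OF assms(1)]) auto
    then show "E (\<lambda>\<omega>. \<phi> (x(n := Y \<omega>))) = E (\<lambda>\<omega>. \<phi> (y(n := Y \<omega>)))" by simp
  next
    fix x show "\<bar>E (\<lambda>\<omega>. \<phi> (x(n := Y \<omega>)))\<bar> \<le> B"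
      by (intro E_bounds inH *)
  next
    fix x y :: "nat \<Rightarrow> real"
    show "\<bar>E (\<lambda>\<omega>. \<phi> (x(n := Y \<omega>))) - E (\<lambda>\<omega>. \<phi> (y(n := Y \<omega>)))\<bar> \<le> L * (\<Sum>i<n. \<bar>x i - y i\<bar>)"
    proof (intro abs_E_diff_le inH)
      fix \<omega>
      show "\<bar>\<phi> (x(n := Y \<omega>)) - \<phi> (y(n := Y \<omega>))\<bar> \<le> L * (\<Sum>i<n. \<bar>x i - y i\<bar>)"
        using *(4)[of "x(n := Y \<omega>)" "y(n := Y \<omega>)"] by simp
    qed
  qed
qed

text \<open>Integrating out the last coordinate of \<open>\<psi>\<close> keeps the hypotheses; the factor \<open>\<phi>\<close> passes through
  each step because \<open>E\<close> is positively homogeneous, hence the restriction to \<open>\<phi> \<ge> 0\<close>.\<close>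
lemma E_mult_indep:
  assumes X: "\<And>i. X i \<in> H" and ind: "indep_seq E X"
    and \<phi>: "bLip k \<phi>" "\<And>x. 0 \<le> \<phi> x"
    and "bLip (k + d) \<psi>" and "\<And>x y. (\<And>i. k \<le> i \<Longrightarrow> x i = y i) \<Longrightarrow> \<psi> x = \<psi> y"
  shows "E (\<lambda>\<omega>. \<phi> (\<lambda>i. X i \<omega>) * \<psi> (\<lambda>i. X i \<omega>))
    = E (\<lambda>\<omega>. \<phi> (\<lambda>i. X i \<omega>) * E (\<lambda>\<omega>. \<psi> (\<lambda>i. X i \<omega>)))"
  using assms(5,6)
proof (induction d arbitrary: \<psi>)
  case 0
  \<comment> \<open>Here \<psi> depends only on coordinates below \<open>k\<close> and also only on
    those from \<open>k\<close> on, so it is constant.\<close>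
  have "\<psi> x = \<psi> (\<lambda>_. 0)" for x
  proof -
    have "\<psi> x = \<psi> (\<lambda>i. if k \<le> i then 0 else x i)"
      by (rule bLip_cong[OF 0(1)]) simp
    also have "\<dots> = \<psi> (\<lambda>_. 0)" by (rule 0(2)) simp
    finally show ?thesis .
  qed
  then obtain c where "\<And>x. \<psi> x = c" by blast
  then show ?case by (simp add: E_const)
next
  case (Suc d)
  let ?n = "k + d"
  define \<psi>' where "\<psi>' x = E (\<lambda>\<omega>. \<psi> (x(?n := X ?n \<omega>)))" for x
  have \<psi>: "bLip (Suc ?n) \<psi>" using Suc.prems(1) by simp
  have step: "E (\<lambda>\<omega>. \<theta> (\<lambda>i. X i \<omega>)) = E (\<lambda>\<omega>. E (\<lambda>\<omega>'. \<theta> ((\<lambda>i. X i \<omega>)(?n := X ?n \<omega>'))))"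
    if "bLip (Suc ?n) \<theta>" for \<theta>
    by (rule ind[unfolded indep_seq_def, rule_format, OF that])
  have \<psi>': "bLip ?n \<psi>'" unfolding \<psi>'_def by (rule bLip_partial_E[OF \<psi> X])
  have tail: "\<psi>' x = \<psi>' y" if "\<And>i. k \<le> i \<Longrightarrow> x i = y i" for x y
  proof -
    have "\<psi> (x(?n := s)) = \<psi> (y(?n := s))" for s
      by (rule Suc.prems(2)) (simp add: that)
    then show ?thesis by (simp add: \<psi>'_def)
  qed
  have fac: "E (\<lambda>\<omega>. \<phi> (x(?n := X ?n \<omega>)) * \<psi> (x(?n := X ?n \<omega>))) = \<phi> x * \<psi>' x" for x
  proof -
    have "\<phi> (x(?n := s)) = \<phi> x" for s by (intro bLip_cong[OF \<phi>(1)]) auto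
    then show ?thesis
      using E_cmult[OF \<phi>(2) bLip_section_in_H[OF \<psi> X]] by (simp add: \<psi>'_def)
  qed
  have "bLip (Suc ?n) (\<lambda>x. \<phi> x * \<psi> x)"
    by (intro bLip_mult bLip_mono[OF \<phi>(1)] \<psi>) auto
  from step[OF this] have "E (\<lambda>\<omega>. \<phi> (\<lambda>i. X i \<omega>) * \<psi> (\<lambda>i. X i \<omega>))
      = E (\<lambda>\<omega>. \<phi> (\<lambda>i. X i \<omega>) * \<psi>' (\<lambda>i. X i \<omega>))"
    by (simp add: fac)
  also have "\<dots> = E (\<lambda>\<omega>. \<phi> (\<lambda>i. X i \<omega>) * E (\<lambda>\<omega>. \<psi>' (\<lambda>i. X i \<omega>)))"
    using \<psi>' tail by (rule Suc.IH)
  \<comment> \<open>Independence applied to \<psi> alone undoes the inner averaging.\<close>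
  also have "E (\<lambda>\<omega>. \<psi>' (\<lambda>i. X i \<omega>)) = E (\<lambda>\<omega>. \<psi> (\<lambda>i. X i \<omega>))"
    using step[OF \<psi>] by (simp add: \<psi>'_def)
  finally show ?case .
qed

end

section \<open>Covariances under one measure of the representing family\<close>

locale represented = sublinear M H E
  for M :: "'a measure" and H E +
  fixes \<P> :: "'a measure set"
  assumes rep: "sublinear_space_rep M \<P> H E"
begin

lemma \<P>_nonempty: "\<P> \<noteq> {}"
  and prob_space_\<P>: "P \<in> \<P> \<Longrightarrow> prob_space P"
  and sets_\<P>: "P \<in> \<P> \<Longrightarrow> sets P = sets M"
  and integrable_\<P>: "P \<in> \<P> \<Longrightarrow> Y \<in> H \<Longrightarrow> integrable P Y"
  using rep unfolding sublinear_space_rep_def by auto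

text \<open>The bound \<open>B\<close> makes the set of integrals bounded above; without this a real
  supremum need not dominate its members.\<close>

lemma integral_le_E:
  assumes "P \<in> \<P>" "Y \<in> H" "\<And>\<omega>. \<bar>Y \<omega>\<bar> \<le> B"
  shows "integral\<^sup>L P Y \<le> E Y"
proof -
  have "integral\<^sup>L Q Y \<le> B" if "Q \<in> \<P>" for Q
  proof -
    interpret prob_space Q using that by (rule prob_space_\<P>)
    have "integral\<^sup>L Q Y \<le> integral\<^sup>L Q (\<lambda>_. B)"
      using integrable_\<P>[OF that assms(2)] assms(3) by (intro integral_mono) (auto intro: order_trans[OF abs_ge_self])
    then show ?thesis by (simp add: prob_space)
  qed
  then have "bdd_above ((\<lambda>Q. integral\<^sup>L Q Y) ` \<P>)" by (intro bdd_aboveI2)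
  then have "integral\<^sup>L P Y \<le> (SUP Q\<in>\<P>. integral\<^sup>L Q Y)"
    using assms(1) by (rule cSUP_upper2) simp
  then show ?thesis using rep assms(2) unfolding sublinear_space_rep_def by simp
qed

text \<open>Here \<open>S\<^sub>l\<close> is replaced by \<open>S\<^sub>l - S\<^sub>k\<close>, at a cost \<open>\<zeta>\<close> of order \<open>b k / b l\<close>, and \<open>h\<close> by
  \<open>h + B \<ge> 0\<close> in the first factor so that independence applies.\<close>
lemma covariance_le:
  fixes b :: "nat \<Rightarrow> real"
  assumes X: "\<And>i. X i \<in> H" and ind: "indep_seq E X" and P: "P \<in> \<P>"
    and B: "0 < B" "\<And>x. \<bar>h x\<bar> \<le> B" and L: "0 < L" "\<And>x y. \<bar>h x - h y\<bar> \<le> L * \<bar>x - y\<bar>"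
    and kl: "k < l" and b: "0 < b k" "0 < b l"
    and \<epsilon>: "0 \<le> \<epsilon>" "E (\<lambda>\<omega>. h ((\<Sum>i<l. X i \<omega>) / b l)) \<le> \<epsilon>" "E (\<lambda>\<omega>. - h ((\<Sum>i<l. X i \<omega>) / b l)) \<le> \<epsilon>"
    and D: "\<And>N. 0 \<le> N \<Longrightarrow> E (\<lambda>\<omega>. min \<bar>(\<Sum>i<k. X i \<omega>) / b k\<bar> N) \<le> D"
  shows "integral\<^sup>L P (\<lambda>\<omega>. h ((\<Sum>i<k. X i \<omega>) / b k) * h ((\<Sum>i<l. X i \<omega>) / b l))
    \<le> 4 * B * (\<epsilon> + L * (b k / b l) * D)"
proof -
  interpret P: prob_space P using P by (rule prob_space_\<P>)
  define r where "r = L * (b k / b l)"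
  have r: "0 < r" using L b by (simp add: r_def)
  define W where "W = (\<lambda>n \<omega>. (\<Sum>i<n. X i \<omega>) / b n)"
  \<comment> \<open>Truncation makes the error bounded and a member of \<open>H\<close>. It loses
    nothing: two values of \<open>h\<close> differ by at most \<open>2 * B\<close>, which is
    \<open>r\<close> times the truncation level.\<close>
  define \<zeta> where "\<zeta> = (\<lambda>\<omega>. r * min \<bar>W k \<omega>\<bar> (2 * B / r))"
  define \<phi> where "\<phi> = (\<lambda>x. h ((\<Sum>i<k. x i) / b k) + B)"
  define \<psi> where "\<psi> = (\<lambda>x. h ((\<Sum>i=k..<l. x i) / b l))"
  define F where "F = (\<lambda>\<omega>. \<phi> (\<lambda>i. X i \<omega>))"
  define Y where "Y = (\<lambda>\<omega>. \<psi> (\<lambda>i. X i \<omega>))"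
  have h: "bLip1 h" using B L unfolding bLip1_def by blast
  have min_H: "(\<lambda>\<omega>. min \<bar>W k \<omega>\<bar> N) \<in> H" if "0 \<le> N" for N
    unfolding W_def using bLip_in_H[OF X bLip_comp_sum[OF bLip1_min_abs[OF that], of "{..<k}" k "b k"]] by simp
  have hW_H: "(\<lambda>\<omega>. h (W n \<omega>)) \<in> H" for n
    unfolding W_def using bLip_in_H[OF X bLip_comp_sum[OF h, of "{..<n}" n "b n"]] by simp
  have \<psi>: "bLip l \<psi>" unfolding \<psi>_def by (rule bLip_comp_sum[OF h]) auto
  have Y_H: "Y \<in> H" unfolding Y_def by (rule bLip_in_H[OF X \<psi>])
  have \<phi>: "bLip k \<phi>" unfolding \<phi>_def by (intro bLip_add bLip_const bLip_comp_sum[OF h]) auto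
  have F_H: "F \<in> H" unfolding F_def by (rule bLip_in_H[OF X \<phi>])
  have FY_H: "(\<lambda>\<omega>. F \<omega> * Y \<omega>) \<in> H"
    using bLip_in_H[OF X bLip_mult[OF bLip_mono[OF \<phi>] \<psi>]] kl by (simp add: F_def Y_def)
  have F_bd: "0 \<le> F \<omega>" "F \<omega> \<le> 2 * B" for \<omega>
    using B(2)[of "(\<Sum>i<k. X i \<omega>) / b k"] by (auto simp: F_def \<phi>_def)
  have Y_bd: "\<bar>Y \<omega>\<bar> \<le> B" for \<omega> unfolding Y_def \<psi>_def by (rule B)
  have \<zeta>_H: "\<zeta> \<in> H" unfolding \<zeta>_def using r B by (intro cmult_in_H min_H) auto
  have \<zeta>_bd: "0 \<le> \<zeta> \<omega>" "\<zeta> \<omega> \<le> 2 * B" for \<omega>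
  proof -
    show "0 \<le> \<zeta> \<omega>" unfolding \<zeta>_def using r B by simp
    have "\<zeta> \<omega> \<le> r * (2 * B / r)" unfolding \<zeta>_def using r by (intro mult_left_mono) auto
    then show "\<zeta> \<omega> \<le> 2 * B" using r by simp
  qed
  have E\<zeta>: "E \<zeta> \<le> r * D"
    using E_cmult[OF _ min_H, of r "2 * B / r"] D[of "2 * B / r"] r B
    by (simp add: \<zeta>_def W_def)
  have E\<zeta>0: "0 \<le> E \<zeta>" using E_mono[OF const_in_H[of 0] \<zeta>_H] \<zeta>_bd by (simp add: E_const)
  have diff: "\<bar>h (W l \<omega>) - Y \<omega>\<bar> \<le> \<zeta> \<omega>" for \<omega>
  proof -
    have "(\<Sum>i<l. X i \<omega>) = (\<Sum>i<k. X i \<omega>) + (\<Sum>i=k..<l. X i \<omega>)"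
      using kl sum.atLeastLessThan_concat[of 0 k l "\<lambda>i. X i \<omega>"] by (simp add: lessThan_atLeast0)
    then have "W l \<omega> - (\<Sum>i=k..<l. X i \<omega>) / b l = W k \<omega> * (b k / b l)"
      using b by (simp add: W_def field_simps)
    then have "\<bar>h (W l \<omega>) - Y \<omega>\<bar> \<le> L * \<bar>W k \<omega> * (b k / b l)\<bar>"
      unfolding Y_def \<psi>_def using L(2) by metis
    then have 1: "\<bar>h (W l \<omega>) - Y \<omega>\<bar> \<le> r * \<bar>W k \<omega>\<bar>"
      using b by (simp add: r_def abs_mult mult_ac)
    have 2: "\<bar>h (W l \<omega>) - Y \<omega>\<bar> \<le> r * (2 * B / r)"
      using B(2)[of "W l \<omega>"] Y_bd[of \<omega>] r by simp
    show ?thesis unfolding \<zeta>_def using 1 2 by (simp add: min_def)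
  qed
  define \<delta> where "\<delta> = \<epsilon> + E \<zeta>"
  have "0 \<le> \<delta>" using \<epsilon> E\<zeta>0 by (simp add: \<delta>_def)
  have EY: "E Y \<le> \<delta>"
  proof -
    have "E Y \<le> E (\<lambda>\<omega>. h (W l \<omega>)) + E \<zeta>"
    proof (rule E_le_add[OF Y_H hW_H \<zeta>_H])
      show "Y \<omega> \<le> h (W l \<omega>) + \<zeta> \<omega>" for \<omega> using diff[of \<omega>] by linarith
    qed
    then show ?thesis using \<epsilon>(2) by (simp add: \<delta>_def W_def)
  qed
  have EmY: "E (\<lambda>\<omega>. - Y \<omega>) \<le> \<delta>"
  proof -
    have "E (\<lambda>\<omega>. - Y \<omega>) \<le> E (\<lambda>\<omega>. - h (W l \<omega>)) + E \<zeta>"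
    proof (rule E_le_add[OF uminus_in_H[OF Y_H] uminus_in_H[OF hW_H] \<zeta>_H])
      show "- Y \<omega> \<le> - h (W l \<omega>) + \<zeta> \<omega>" for \<omega> using diff[of \<omega>] by linarith
    qed
    then show ?thesis using \<epsilon>(3) by (simp add: \<delta>_def W_def)
  qed
  have EFY: "E (\<lambda>\<omega>. F \<omega> * Y \<omega>) \<le> 2 * B * \<delta>"
  proof -
    have "E (\<lambda>\<omega>. F \<omega> * Y \<omega>) = E (\<lambda>\<omega>. F \<omega> * E Y)"
      unfolding F_def Y_def
    proof (rule E_mult_indep[OF X ind \<phi>])
      show "0 \<le> \<phi> x" for x using B(2)[of "(\<Sum>i<k. x i) / b k"] by (auto simp: \<phi>_def)
      show "bLip (k + (l - k)) \<psi>" using \<psi> kl by simp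
      show "\<psi> x = \<psi> y" if "\<And>i. k \<le> i \<Longrightarrow> x i = y i" for x y
        using that by (simp add: \<psi>_def)
    qed
    \<comment> \<open>\<open>E Y\<close> may be negative, so the estimate passes through
      \<open>F \<omega> * \<delta>\<close>, using \<open>0 \<le> F \<omega> \<le> 2 * B\<close> and
      \<open>0 \<le> \<delta>\<close>.\<close>
    also have "\<dots> \<le> E (\<lambda>\<omega>. 2 * B * \<delta>)"
    proof (rule E_mono[OF _ const_in_H])
      show "(\<lambda>\<omega>. F \<omega> * E Y) \<in> H" using cmult_in_H[OF F_H, of "E Y"] by (simp add: mult.commute)
      show "F \<omega> * E Y \<le> 2 * B * \<delta>" for \<omega>
        using F_bd[of \<omega>] EY \<open>0 \<le> \<delta>\<close>
        by (meson mult_left_mono mult_right_mono order_trans)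
    qed
    finally show ?thesis by (simp add: E_const)
  qed
  have I1: "integral\<^sup>L P \<zeta> \<le> E \<zeta>"
    using \<zeta>_bd by (intro integral_le_E[OF P \<zeta>_H, of "2 * B"]) auto
  have I2: "integral\<^sup>L P (\<lambda>\<omega>. F \<omega> * Y \<omega>) \<le> 2 * B * \<delta>"
  proof (rule order_trans[OF integral_le_E[OF P FY_H] EFY])
    show "\<bar>F \<omega> * Y \<omega>\<bar> \<le> 2 * B * B" for \<omega>
      unfolding abs_mult using F_bd[of \<omega>] Y_bd[of \<omega>] by (intro mult_mono) auto
  qed
  have I3: "integral\<^sup>L P (\<lambda>\<omega>. - Y \<omega>) \<le> \<delta>"
    using Y_bd by (intro order_trans[OF integral_le_E[OF P uminus_in_H[OF Y_H], of B] EmY]) auto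
  \<comment> \<open>Write the product as
    \<open>h (W k) * (h (W l) - Y) + (h (W k) + B) * Y - B * Y\<close>. The last two terms keep
    \<open>Y\<close> and \<open>- Y\<close> apart because \<open>E\<close> is only
    sub-additive.\<close>
  have pt: "h (W k \<omega>) * h (W l \<omega>) \<le> B * \<zeta> \<omega> + F \<omega> * Y \<omega> + B * (- Y \<omega>)" for \<omega>
  proof -
    have "h (W k \<omega>) * (h (W l \<omega>) - Y \<omega>) \<le> \<bar>h (W k \<omega>)\<bar> * \<bar>h (W l \<omega>) - Y \<omega>\<bar>"
      by (metis abs_ge_self abs_mult)
    also have "\<dots> \<le> B * \<zeta> \<omega>" using B diff[of \<omega>] by (intro mult_mono) auto
    finally show ?thesis by (simp add: F_def \<phi>_def W_def algebra_simps)
  qed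
  note ints = integrable_\<P>[OF P \<zeta>_H] integrable_\<P>[OF P FY_H] integrable_\<P>[OF P uminus_in_H[OF Y_H]]
  have "integral\<^sup>L P (\<lambda>\<omega>. h (W k \<omega>) * h (W l \<omega>))
      \<le> integral\<^sup>L P (\<lambda>\<omega>. B * \<zeta> \<omega> + F \<omega> * Y \<omega> + B * (- Y \<omega>))"
  proof (rule integral_mono[OF _ _ pt])
    have "(\<lambda>\<omega>. h (W k \<omega>) * h (W l \<omega>)) \<in> H"
      using bLip_in_H[OF X bLip_mult[OF bLip_mono[OF bLip_comp_sum[OF h, of "{..<k}" k "b k"]]
            bLip_comp_sum[OF h, of "{..<l}" l "b l"]]] kl by (simp add: W_def)
    then show "integrable P (\<lambda>\<omega>. h (W k \<omega>) * h (W l \<omega>))" by (rule integrable_\<P>[OF P])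
    show "integrable P (\<lambda>\<omega>. B * \<zeta> \<omega> + F \<omega> * Y \<omega> + B * (- Y \<omega>))"
      by (intro Bochner_Integration.integrable_add integrable_mult_right ints)
  qed
  also have "\<dots> = B * integral\<^sup>L P \<zeta> + integral\<^sup>L P (\<lambda>\<omega>. F \<omega> * Y \<omega>) + B * integral\<^sup>L P (\<lambda>\<omega>. - Y \<omega>)"
    using ints by simp
  also have "\<dots> \<le> B * E \<zeta> + 2 * B * \<delta> + B * \<delta>"
    using B I1 I2 I3 by (intro add_mono mult_left_mono) auto
  \<comment> \<open>As \<open>0 \<le> \<epsilon>\<close>, the term \<open>E \<zeta>\<close> is at
    most \<delta>, so the three summands contribute 1, 2 and 1 times
    \<open>B * \<delta>\<close>.\<close>
  also have "\<dots> \<le> 4 * B * \<delta>"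
    using \<epsilon>(1) B by (simp add: \<delta>_def algebra_simps)
  also have "\<dots> \<le> 4 * B * (\<epsilon> + r * D)"
    using E\<zeta> B by (intro mult_left_mono) (auto simp: \<delta>_def)
  finally show ?thesis by (simp add: W_def r_def)
qed

end

subsection \<open>The convergence rate of the normalised sums\<close>

text \<open>Uniform bounds on the variances give \<open>Bn\<close> the exact order of the square
  root of \<open>n\<close>.\<close>

lemma (in sublinear) sig_mid_bounds:
  assumes seq: "seq_hyps H E \<beta> X" and \<beta>: "1 \<le> \<beta>"
  obtains s t where "0 < s" "0 < t" "\<And>i. s \<le> sig_mid E (X i)" "\<And>i. sig_mid E (X i) \<le> t"
proof -
  obtain c C where c: "0 < c" "\<And>i. c \<le> (sig_low E (X i))\<^sup>2" and C: "\<And>i. (sig_up E (X i))\<^sup>2 \<le> C"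
    using seq unfolding seq_hyps_def by blast
  have sq: "(\<lambda>\<omega>. (X i \<omega>)\<^sup>2) \<in> H" and ratio: "sig_up E (X i) / sig_low E (X i) = \<beta>" for i
    using seq unfolding seq_hyps_def by blast+
  \<comment> \<open>The real \<open>sqrt\<close> is negative at negative arguments, so the sign must
    come from \<open>E\<close> of a nonpositive variable being nonpositive.\<close>
  have low0: "0 \<le> sig_low E (X i)" for i
    using E_mono[OF uminus_in_H[OF sq] const_in_H[of 0], of i] by (simp add: sig_low_def E_const)
  have low: "sqrt c \<le> sig_low E (X i)" for i
    using c(2)[of i] low0 by (simp add: real_le_lsqrt)
  have up: "sig_low E (X i) \<le> sig_up E (X i)" for i
  proof -
    have pos: "0 < sig_low E (X i)" using low[of i] c(1) by (meson less_le_trans real_sqrt_gt_zero)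
    then have "sig_up E (X i) = \<beta> * sig_low E (X i)" using ratio[of i] by (simp add: field_simps)
    then show ?thesis using \<beta> pos by simp
  qed
  have up_le: "sig_up E (X i) \<le> sqrt C" for i
    using C[of i] by (simp add: real_le_rsqrt)
  show ?thesis
  proof
    show "0 < sqrt c" using c by simp
    show "sqrt c \<le> sig_mid E (X i)" for i using low[of i] up[of i] by (simp add: sig_mid_def)
    show "sig_mid E (X i) \<le> sqrt C" for i using up[of i] up_le[of i] by (simp add: sig_mid_def)
    then show "0 < sqrt C" using \<open>0 < sqrt c\<close> low[of 0] up[of 0] up_le[of 0] by linarith
  qed
qed

lemma Bn_bounds:
  assumes "0 < s" "\<And>i. s \<le> sig_mid E (X i)" "\<And>i. sig_mid E (X i) \<le> t"
  shows "s * sqrt n \<le> Bn E X n" "Bn E X n \<le> t * sqrt n"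
proof -
  have t: "0 < t" using assms(1) assms(2)[of 0] assms(3)[of 0] by linarith
  have "(\<Sum>i<n. s\<^sup>2) \<le> (\<Sum>i<n. (sig_mid E (X i))\<^sup>2)"
    using assms by (intro sum_mono power_mono) auto
  then have "sqrt (real n * s\<^sup>2) \<le> Bn E X n" by (simp add: Bn_def)
  then show "s * sqrt n \<le> Bn E X n" using assms(1) by (simp add: real_sqrt_mult mult.commute)
  have "0 \<le> sig_mid E (X i)" for i using assms(1) assms(2)[of i] by linarith
  then have "(\<Sum>i<n. (sig_mid E (X i))\<^sup>2) \<le> (\<Sum>i<n. t\<^sup>2)"
    using assms by (intro sum_mono power_mono) auto
  then have "Bn E X n \<le> sqrt (real n * t\<^sup>2)" by (simp add: Bn_def)
  then show "Bn E X n \<le> t * sqrt n" using t by (simp add: real_sqrt_mult mult.commute)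
qed

text \<open>Inside the maximum the powers of \<open>sig_mid\<close> combine to
  \<open>1 / (sig_mid\<^sup>2 * Bn powr \<alpha>)\<close>. With moments bounded,
  \<open>sig_mid\<close> at least \<open>s\<close> and \<open>Bn\<close> at least
  \<open>s * sqrt n\<close>, the order is \<open>n powr - (\<alpha> / 2)\<close>, uniformly in
  \<open>g\<close>.\<close>

lemma song_rate:
  assumes seq: "seq_hyps H E \<beta> X" and song: "song_constant \<P> H E Et \<xi> \<beta> \<alpha>"
    and moment: "(SUP i. upper_nn \<P> (\<lambda>\<omega>. \<bar>X i \<omega>\<bar> powr (2 + \<alpha>))) < \<infinity>"
    and \<alpha>: "0 < \<alpha>" and s: "0 < s" "\<And>i. s \<le> sig_mid E (X i)" "\<And>i. sig_mid E (X i) \<le> t"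
  shows "\<exists>D>0. \<forall>n\<ge>1. \<forall>g. bLip1 g \<longrightarrow> (\<forall>x y. \<bar>g x - g y\<bar> \<le> \<bar>x - y\<bar>) \<longrightarrow>
    \<bar>E (\<lambda>\<omega>. g (Wn E X n \<omega>)) - Et (\<lambda>\<omega>. g (\<xi> \<omega>))\<bar> \<le> D * real n powr - (\<alpha> / 2)"
proof -
  define u where "u i = upper_nn \<P> (\<lambda>\<omega>. \<bar>X i \<omega>\<bar> powr (2 + \<alpha>))" for i
  define K where "K = enn2real (SUP i. u i)"
  have uK: "enn2real (u i) \<le> K" for i
    unfolding K_def using moment by (intro enn2real_mono SUP_upper) (auto simp: u_def)
  obtain C where "0 < C" and C: "\<And>n g. 1 \<le> n \<Longrightarrow> bLip1 g \<Longrightarrow> (\<And>x y. \<bar>g x - g y\<bar> \<le> \<bar>x - y\<bar>) \<Longrightarrow>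
      \<bar>E (\<lambda>\<omega>. g (Wn E X n \<omega>)) - Et (\<lambda>\<omega>. g (\<xi> \<omega>))\<bar> \<le>
      C * (MAX i\<in>{..<n}. enn2real (u i) / sig_mid E (X i) powr (2 + \<alpha>) * (sig_mid E (X i) / Bn E X n) powr \<alpha>)"
    using song seq moment unfolding song_constant_def u_def by blast
  define D where "D = K / (s\<^sup>2 * s powr \<alpha>)"
  have D: "0 \<le> D" unfolding D_def K_def using s by simp
  have term_le: "enn2real (u i) / sig_mid E (X i) powr (2 + \<alpha>) * (sig_mid E (X i) / Bn E X n) powr \<alpha>
      \<le> D * real n powr - (\<alpha> / 2)" if n: "1 \<le> n" for i n
  proof -
    let ?\<sigma> = "sig_mid E (X i)" and ?b = "Bn E X n"
    have \<sigma>: "0 < ?\<sigma>" using s(1) s(2)[of i] by linarith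
    have b: "s * sqrt n \<le> ?b" using Bn_bounds[of s E X t, OF s] by blast
    have sn: "0 < s * sqrt n" using s n by simp
    then have b0: "0 < ?b" using b by linarith
    have "enn2real (u i) / ?\<sigma> powr (2 + \<alpha>) * (?\<sigma> / ?b) powr \<alpha> = enn2real (u i) / (?\<sigma>\<^sup>2 * ?b powr \<alpha>)"
      using \<sigma> b0 by (simp add: powr_add powr_divide)
    also have "\<dots> \<le> K / (s\<^sup>2 * (s * sqrt n) powr \<alpha>)"
      using uK[of i] s n sn b b0 \<alpha> by (intro frac_le mult_mono power_mono powr_mono2 mult_pos_pos) (auto simp: K_def)
    also have "(s * sqrt n) powr \<alpha> = s powr \<alpha> * real n powr (\<alpha> / 2)"
      using s n by (simp add: powr_mult powr_half_sqrt[symmetric] powr_powr)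
    also have "K / (s\<^sup>2 * (s powr \<alpha> * real n powr (\<alpha> / 2))) = D * real n powr - (\<alpha> / 2)"
      using n by (simp add: D_def powr_minus field_simps)
    finally show ?thesis .
  qed
  show ?thesis
  proof (intro exI[of _ "C * D + 1"] conjI allI impI)
    \<comment> \<open>The added 1 keeps the constant strictly positive even if
      \<open>D = 0\<close>.\<close>
    show "0 < C * D + 1" using D \<open>0 < C\<close> by (simp add: add_nonneg_pos)
    fix n :: nat and g :: "real \<Rightarrow> real"
    assume *: "1 \<le> n" "bLip1 g" "\<forall>x y. \<bar>g x - g y\<bar> \<le> \<bar>x - y\<bar>"
    have "\<bar>E (\<lambda>\<omega>. g (Wn E X n \<omega>)) - Et (\<lambda>\<omega>. g (\<xi> \<omega>))\<bar> \<le> C * (D * real n powr - (\<alpha> / 2))"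
    proof (rule order_trans[OF C[OF *[rule_format]]], rule mult_left_mono)
      show "(MAX i\<in>{..<n}. enn2real (u i) / sig_mid E (X i) powr (2 + \<alpha>) * (sig_mid E (X i) / Bn E X n) powr \<alpha>)
          \<le> D * real n powr - (\<alpha> / 2)"
        using *(1) term_le[OF *(1)] by (subst Max_le_iff) (auto simp: lessThan_empty_iff)
    qed (use \<open>0 < C\<close> in simp)
    also have "\<dots> \<le> (C * D + 1) * real n powr - (\<alpha> / 2)" by (simp add: algebra_simps)
    finally show "\<bar>E (\<lambda>\<omega>. g (Wn E X n \<omega>)) - Et (\<lambda>\<omega>. g (\<xi> \<omega>))\<bar> \<le> (C * D + 1) * real n powr - (\<alpha> / 2)" .
  qed
qed

section \<open>Covariance decay for the normalised sums and the logarithmic law\<close>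

theorem theorem4p1:
  fixes M :: "'a measure" and \<P> :: "'a measure set"
    and H :: "('a \<Rightarrow> real) set" and E :: "('a \<Rightarrow> real) \<Rightarrow> real"
    and Mt :: "'b measure" and Ht :: "('b \<Rightarrow> real) set" and Et :: "('b \<Rightarrow> real) \<Rightarrow> real"
    and X :: "nat \<Rightarrow> 'a \<Rightarrow> real" and \<xi> :: "'b \<Rightarrow> real"
    and \<beta> \<alpha> :: real and f :: "real \<Rightarrow> real"
  assumes beta: "\<beta> \<ge> 1"
    and space: "sublinear_space_rep M \<P> H E"
    and space_t: "sublinear_expectation Mt Ht Et"
    and condA: "condA H E" and condA_t: "condA Ht Et"
    and seq: "seq_hyps H E \<beta> X"
    and xi: "G_normal Ht Et \<xi>"
    and xi_up: "sqrt (Et (\<lambda>\<omega>. (\<xi> \<omega>)\<^sup>2)) = 2 * \<beta> / (1 + \<beta>)"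
    and xi_low: "sqrt (- Et (\<lambda>\<omega>. - (\<xi> \<omega>)\<^sup>2)) = 2 / (1 + \<beta>)"
    and alpha: "0 < \<alpha>" "\<alpha> < 1"
    and song: "song_constant \<P> H E Et \<xi> \<beta> \<alpha>"
    and moment: "(SUP i. upper_nn \<P> (\<lambda>\<omega>. \<bar>X i \<omega>\<bar> powr (2 + \<alpha>))) < \<infinity>"
    and f: "bLip1 f" "Et (\<lambda>\<omega>. f (\<xi> \<omega>)) = - Et (\<lambda>\<omega>. - f (\<xi> \<omega>))"
  shows "lower_cap \<P>
           {\<omega> \<in> space M.
              (\<lambda>n. (1 / ln (real n)) * (\<Sum>k=1..n. (1 / real k) * f (Wn E X k \<omega>)))
                \<longlonglongrightarrow> Et (\<lambda>\<omega>. f (\<xi> \<omega>))} = 1"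
proof -
  interpret represented M H E \<P>
    using space by unfold_locales (auto simp: sublinear_space_rep_def)
  interpret T: sublinear Mt Ht Et by unfold_locales (rule space_t)
  define m where "m = Et (\<lambda>\<omega>. f (\<xi> \<omega>))"
  define h where "h x = f x - m" for x
  define W where "W = Wn E X"
  have X: "X i \<in> H" for i using seq unfolding seq_hyps_def by blast
  have ind: "indep_seq E X" using seq unfolding seq_hyps_def by blast
  have \<xi>: "\<xi> \<in> Ht" "(\<lambda>\<omega>. (\<xi> \<omega>)\<^sup>2) \<in> Ht" using xi unfolding G_normal_def by blast+
  have h: "bLip1 h" using bLip1_diff_const[OF f(1), of m] by (simp add: h_def[abs_def])
  obtain B L where B: "0 < B" "\<And>x. \<bar>h x\<bar> \<le> B" and L: "0 < L" "\<And>x y. \<bar>h x - h y\<bar> \<le> L * \<bar>x - y\<bar>"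
    by (rule bLip1_pos_bounds[OF h]) (rule that)
  obtain s t where st: "0 < s" "0 < t" "\<And>i. s \<le> sig_mid E (X i)" "\<And>i. sig_mid E (X i) \<le> t"
    by (rule sig_mid_bounds[OF seq beta]) (rule that)
  note Bn = Bn_bounds[of s E X t, OF st(1,3,4)]
  obtain D where "0 < D" and rate1: "\<forall>n\<ge>1. \<forall>g. bLip1 g \<longrightarrow> (\<forall>x y. \<bar>g x - g y\<bar> \<le> \<bar>x - y\<bar>) \<longrightarrow>
      \<bar>E (\<lambda>\<omega>. g (W n \<omega>)) - Et (\<lambda>\<omega>. g (\<xi> \<omega>))\<bar> \<le> D * real n powr - (\<alpha> / 2)"
    using song_rate[OF seq song moment alpha(1) st(1,3,4)] unfolding W_def by blast
  note D = \<open>0 < D\<close> rate1[rule_format]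
  have gW_H: "(\<lambda>\<omega>. g (W n \<omega>)) \<in> H" if "bLip1 g" for g n
    using bLip_in_H[OF X bLip_comp_sum[OF that, of "{..<n}" n "Bn E X n"]] by (simp add: W_def Wn_def)
  \<comment> \<open>This is where membership of \<open>f\<close> in the class without mean
    uncertainty enters: both \<open>h\<close> and \<open>- h\<close> have mean zero at
    \<xi>.\<close>
  have Et_h: "Et (\<lambda>\<omega>. h (\<xi> \<omega>)) = 0" "Et (\<lambda>\<omega>. - h (\<xi> \<omega>)) = 0"
    unfolding h_def m_def
    by (rule T.E_centered_eq_0[OF T.bLip1_in_H[OF f(1) \<xi>(1)] refl], use f(2) in linarith)+
  \<comment> \<open>Song's bound is stated for Lipschitz constant 1, so it is applied to
    \<open>g / L\<close>.\<close>
  have rate: "E (\<lambda>\<omega>. g (W n \<omega>)) \<le> L * D * real n powr - (\<alpha> / 2)"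
    if n: "1 \<le> n" and g: "bLip1 g" "\<And>x y. \<bar>g x - g y\<bar> \<le> L * \<bar>x - y\<bar>" "Et (\<lambda>\<omega>. g (\<xi> \<omega>)) = 0" for g n
  proof -
    have "\<bar>1 / L * g x - 1 / L * g y\<bar> \<le> \<bar>x - y\<bar>" for x y
      using g(2)[of x y] L(1) by (simp add: right_diff_distrib[symmetric] abs_mult field_simps)
    from D(2)[OF n bLip1_cmult[OF g(1), of "1 / L"] this]
    have "\<bar>1 / L * E (\<lambda>\<omega>. g (W n \<omega>)) - 1 / L * Et (\<lambda>\<omega>. g (\<xi> \<omega>))\<bar> \<le> D * real n powr - (\<alpha> / 2)"
      using E_cmult[OF _ gW_H[OF g(1)], of "1 / L"] T.E_cmult[OF _ T.bLip1_in_H[OF g(1) \<xi>(1)], of "1 / L"] L(1)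
      by simp
    then have "1 / L * E (\<lambda>\<omega>. g (W n \<omega>)) \<le> D * real n powr - (\<alpha> / 2)"
      using g(3) by (metis abs_le_D1 diff_zero mult_zero_right)
    then show ?thesis using L(1) by (simp add: field_simps)
  qed
  have up: "E (\<lambda>\<omega>. h (W n \<omega>)) \<le> L * D * real n powr - (\<alpha> / 2)" if "1 \<le> n" for n
    by (rule rate[OF that h L(2) Et_h(1)])
  \<comment> \<open>As \<open>E\<close> is not linear, the bound for \<open>- h\<close> does not
    follow from the one for \<open>h\<close>.\<close>
  have dn: "E (\<lambda>\<omega>. - h (W n \<omega>)) \<le> L * D * real n powr - (\<alpha> / 2)" if "1 \<le> n" for n
  proof (rule rate[OF that])
    show "bLip1 (\<lambda>x. - h x)" using bLip1_cmult[OF h, of "-1"] by simp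
    show "\<bar>- h x - - h y\<bar> \<le> L * \<bar>x - y\<bar>" for x y using L(2)[of x y] by linarith
  qed (rule Et_h)
  \<comment> \<open>The constant comes from \<open>\<bar>x\<bar> \<le> x\<^sup>2 + 1\<close> at
    \<xi>, plus the error \<open>D\<close> of the rate; it is free of both \<open>n\<close> and
    \<open>N\<close>.\<close>
  define D' where "D' = Et (\<lambda>\<omega>. (\<xi> \<omega>)\<^sup>2) + 1 + D"
  have trunc: "E (\<lambda>\<omega>. min \<bar>W n \<omega>\<bar> N) \<le> D'" if n: "1 \<le> n" and N: "0 \<le> N" for n N
  proof -
    have "Et (\<lambda>\<omega>. min \<bar>\<xi> \<omega>\<bar> N) \<le> Et (\<lambda>\<omega>. (\<xi> \<omega>)\<^sup>2) + Et (\<lambda>\<omega>. 1)"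
    proof (rule T.E_le_add[OF T.bLip1_in_H[OF bLip1_min_abs[OF N] \<xi>(1)] \<xi>(2) T.const_in_H])
      have "\<bar>x\<bar> \<le> x\<^sup>2 + 1" for x :: real
        using zero_le_power2[of "\<bar>x\<bar> - 1"] by (simp add: power2_diff)
      then show "min \<bar>\<xi> \<omega>\<bar> N \<le> (\<xi> \<omega>)\<^sup>2 + 1" for \<omega> by (meson min.coboundedI1)
    qed
    moreover have "\<bar>E (\<lambda>\<omega>. min \<bar>W n \<omega>\<bar> N) - Et (\<lambda>\<omega>. min \<bar>\<xi> \<omega>\<bar> N)\<bar> \<le> D * real n powr - (\<alpha> / 2)"
      by (rule D(2)[OF n bLip1_min_abs[OF N]]) auto
    moreover have "D * real n powr - (\<alpha> / 2) \<le> D * 1"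
      using D(1) n alpha by (intro mult_left_mono) (auto simp: powr_minus_divide ge_one_powr_ge_zero)
    ultimately show ?thesis unfolding D'_def T.E_const by linarith
  qed
  have D': "0 \<le> D'"
    using trunc[of 1 0] by (simp add: E_const)
  \<comment> \<open>The summand \<open>B\<^sup>2\<close> serves the diagonal \<open>k = l\<close>,
    the other one the case \<open>k < l\<close>.\<close>
  define C where "C = B\<^sup>2 + 4 * B * (L * D + L * (t / s) * D')"
  have C: "B\<^sup>2 \<le> C" "4 * B * (L * D + L * (t / s) * D') \<le> C"
    using B(1) L(1) st(1,2) D(1) D' by (auto simp: C_def)
  have cov: "integral\<^sup>L P (\<lambda>\<omega>. h (W k \<omega>) * h (W l \<omega>)) \<le> C * (real k / real l) powr (\<alpha> / 2)"
    if P: "P \<in> \<P>" and k: "1 \<le> k" and kl: "k \<le> l" for P k l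
  proof (cases "k = l")
    case True
    interpret P: prob_space P using P by (rule prob_space_\<P>)
    have sq: "h x * h x \<le> B\<^sup>2" for x
      using B(2)[of x] by (metis abs_le_square_iff abs_of_pos B(1) power2_eq_square)
    have "integral\<^sup>L P (\<lambda>\<omega>. h (W k \<omega>) * h (W k \<omega>)) \<le> integral\<^sup>L P (\<lambda>_. B\<^sup>2)"
      using sq by (intro integral_mono') auto
    then show ?thesis using True k C(1) by (simp add: P.prob_space)
  next
    case False
    then have kl': "k < l" using kl by simp
    define q where "q = (real k / real l) powr (\<alpha> / 2)"
    have pos: "0 < Bn E X n" if "1 \<le> n" for n
      using less_le_trans[OF _ Bn(1)[of n]] st(1) that by simp
    have l: "1 \<le> l" using k kl by simp
    have "integral\<^sup>L P (\<lambda>\<omega>. h (W k \<omega>) * h (W l \<omega>))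
        \<le> 4 * B * (L * D * real l powr - (\<alpha> / 2) + L * (Bn E X k / Bn E X l) * D')"
      unfolding W_def Wn_def
      using up[OF l] dn[OF l] trunc[OF k] L(1) D(1)
      by (intro covariance_le[OF X ind P B L kl' pos[OF k] pos[OF l]]) (auto simp: W_def Wn_def)
    \<comment> \<open>Both errors are compared with \<open>q\<close>:
      \<open>1 / l \<le> k / l\<close> for the rate, and for the ratio of the \<open>Bn\<close>, of
      order \<open>sqrt (k / l)\<close>, the fact that \<open>k / l \<le> 1\<close> and
      \<open>\<alpha> / 2 \<le> 1 / 2\<close>.\<close>
    also have "\<dots> \<le> 4 * B * (L * D * q + L * (t / s * q) * D')"
    proof (intro mult_left_mono mult_right_mono add_mono)
      have "real l powr - (\<alpha> / 2) = (1 / real l) powr (\<alpha> / 2)"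
        using l by (simp add: powr_minus powr_divide field_simps)
      also have "\<dots> \<le> q" unfolding q_def using k l alpha by (intro powr_mono2 divide_right_mono) auto
      finally show "real l powr - (\<alpha> / 2) \<le> q" .
      have "Bn E X k / Bn E X l \<le> (t * sqrt k) / (s * sqrt l)"
        using Bn(2)[of k] Bn(1)[of l] st(1,2) l pos[OF k] by (intro frac_le) auto
      also have "\<dots> = t / s * (real k / real l) powr (1 / 2)"
        by (simp add: powr_half_sqrt real_sqrt_divide)
      also have "\<dots> \<le> t / s * q"
        unfolding q_def using st(1,2) k kl alpha by (intro mult_left_mono powr_mono') auto
      finally show "Bn E X k / Bn E X l \<le> t / s * q" .
    qed (use B(1) L(1) D(1) D' in auto)
    also have "\<dots> = 4 * B * (L * D + L * (t / s) * D') * q" by (simp add: algebra_simps)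
    also have "\<dots> \<le> C * q" using C(2) by (intro mult_right_mono) (auto simp: q_def)
    finally show ?thesis by (simp add: q_def)
  qed
  let ?A = "{\<omega> \<in> space M. (\<lambda>n. (1 / ln (real n)) * (\<Sum>k=1..n. (1 / real k) * f (W k \<omega>))) \<longlonglongrightarrow> m}"
  have "measure P ?A = 1" if P: "P \<in> \<P>" for P
  proof -
    interpret P: prob_space P using P by (rule prob_space_\<P>)
    have sets: "sets P = sets M" using P by (rule sets_\<P>)
    have sp: "space M = space P" using sets by (metis sets_eq_imp_space_eq)
    have meas: "(\<lambda>\<omega>. g (W k \<omega>)) \<in> borel_measurable P" if "bLip1 g" for g k
      using measurable_H[OF gW_H[OF that]] by (simp add: measurable_cong_sets[OF sets refl])
    note [measurable] = meas[OF f(1)]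
    have "AE \<omega> in P. (\<lambda>n. (\<Sum>k=1..n. h (W k \<omega>) / real k) / ln (real n)) \<longlonglongrightarrow> 0"
      using alpha C(1) by (intro P.log_average_tendsto_0_of_cov_decay[OF meas[OF h] B(2) cov[OF P]])
        (auto intro: order_trans[OF zero_le_power2])
    then have "AE \<omega> in P. (\<lambda>n. (1 / ln (real n)) * (\<Sum>k=1..n. (1 / real k) * f (W k \<omega>))) \<longlonglongrightarrow> m"
    proof eventually_elim
      case (elim \<omega>)
      \<comment> \<open>Splitting \<open>f = h + m\<close> leaves \<open>m\<close> times the
        harmonic sum over \<open>ln n\<close>, which tends to \<open>m\<close>.\<close>
      have "(1 / ln (real n)) * (\<Sum>k=1..n. (1 / real k) * f (W k \<omega>))
          = (\<Sum>k=1..n. h (W k \<omega>) / real k) / ln (real n) + m * ((\<Sum>k=1..n. 1 / real k) / ln (real n))" for n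
      proof -
        have "(\<Sum>k=1..n. (1 / real k) * f (W k \<omega>)) = (\<Sum>k=1..n. h (W k \<omega>) / real k) + m * (\<Sum>k=1..n. 1 / real k)"
          unfolding sum_distrib_left sum.distrib[symmetric]
          by (intro sum.cong) (auto simp: h_def diff_divide_distrib)
        then show ?thesis by (simp add: add_divide_distrib)
      qed
      then show ?case
        using tendsto_add[OF elim tendsto_mult_left[OF harmonic_sum_over_ln_tendsto, of m]] by simp
    qed
    moreover have "?A \<in> sets P" unfolding sp by measurable
    ultimately show ?thesis unfolding sp by (subst P.prob_Collect_eq_1)
  qed
  \<comment> \<open>Each measure gives the event probability 1, and the family is nonempty, so the
    infimum of the constant 1 is 1.\<close>
  then have "(INF P\<in>\<P>. measure P ?A) = (INF P\<in>\<P>. 1)" by (intro INF_cong) auto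
  then show ?thesis using \<P>_nonempty by (simp add: lower_cap_def W_def m_def)
qed

end
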